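(* Let $\mu$ be a Lamperti stable distribution on $\mathbb{R}^d$ with Lévy measure $\nu^{\alpha,f}_\sigma$. Then $$\int_{\mathbb{R}^d}\|x\|^p\mu(dx)<\infty\quad\text{for all }p>0.$$ Let $\gamma:=\sup_{\xi\in S^{d-1}}f(\xi)$. If $\zeta<\alpha+1-\gamma$, then $$\int_{\mathbb{R}^d}e^{\zeta\|x\|}\mu(dx)<\infty.$$ In particular, if $\kappa<\alpha+1$ and $f\equiv\kappa$, then $$\int_{\mathbb{R}^d}e^{\zeta\|x\|}\mu(dx)<\infty\quad\text{if and only if}\quad\zeta<\alpha+1-\kappa.$$
   Context: An infinitely divisible probability measure $\mu$ on $\mathbb{R}^d$ without Gaussian component is called Lamperti stable if its Lévy measure on $\mathbb{R}^d_0=\mathbb{R}^d\setminus\{0\}$ is $$\nu^{\alpha,f}_\sigma(B)=\int_{S^{d-1}}\sigma(d\xi)\int_0^\infty1_B(r\xi)e^{rf(\xi)}(e^r-1)^{-(\alpha+1)}dr,\quad B\in\mathcal{B}(\mathbb{R}^d_0),$$ where $\alpha\in(0,2)$, $\sigma$ is a non-zero finite measure on the unit sphere $S^{d-1}$, and $f:S^{d-1}\to\mathbb{R}$ is a measurable function with $\sup_{\xi\in S^{d-1}}f(\xi)<\alpha+1$. *)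

theory Defs
  imports "HOL-Probability.Probability"
begin

definition vec_char :: "(real^'n) measure \<Rightarrow> real^'n \<Rightarrow> complex" where
  "vec_char \<mu> z = (CLINT x|\<mu>. iexp (inner z x))"

primrec conv_power :: "nat \<Rightarrow> (real^'n) measure \<Rightarrow> (real^'n) measure" where
  "conv_power 0 \<rho> = return borel 0"
| "conv_power (Suc n) \<rho> = (\<rho> \<star> conv_power n \<rho>)"

definition infinitely_divisible :: "(real^'n) measure \<Rightarrow> bool" where
  "infinitely_divisible \<mu> \<longleftrightarrow>
     prob_space \<mu> \<and> sets \<mu> = sets borel \<and>
     (\<forall>n\<ge>1. \<exists>\<rho>. prob_space \<rho> \<and> sets \<rho> = sets borel \<and> \<mu> = conv_power n \<rho>)"

text \<open>Levy measures live on the punctured space, so no condition at the origin is needed.\<close>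

definition levy_measure :: "(real^'n) measure \<Rightarrow> bool" where
  "levy_measure \<nu> \<longleftrightarrow>
     sets \<nu> = sets (restrict_space borel (- {0})) \<and>
     (\<integral>\<^sup>+x. ennreal (min 1 ((norm x)\<^sup>2)) \<partial>\<nu>) < \<infinity>"

text \<open>The Levy--Khintchine representation with Gaussian covariance matrix \<open>A\<close>, Levy measure \<open>\<nu>\<close>
  and location \<open>b\<close>, with truncation function \<open>indicator (cball 0 1)\<close>.\<close>

definition has_generating_triplet ::
    "(real^'n) measure \<Rightarrow> real^'n^'n \<Rightarrow> (real^'n) measure \<Rightarrow> real^'n \<Rightarrow> bool" where
  "has_generating_triplet \<mu> A \<nu> b \<longleftrightarrow>
     transpose A = A \<and> (\<forall>z. 0 \<le> inner z (A *v z)) \<and> levy_measure \<nu> \<and>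
     (\<forall>z. vec_char \<mu> z =
        exp (- complex_of_real (inner z (A *v z)) / 2
             + (CLINT x|\<nu>. iexp (inner z x) - 1
                  - \<i> * complex_of_real (inner z x * indicator (cball 0 1) x))
             + \<i> * complex_of_real (inner b z)))"

definition lamperti_levy :: "real \<Rightarrow> (real^'n \<Rightarrow> real) \<Rightarrow> (real^'n) measure \<Rightarrow> (real^'n) measure" where
  "lamperti_levy \<alpha> f \<sigma> =
     measure_of (- {0}) (sets (restrict_space borel (- {0})))
       (\<lambda>B. \<integral>\<^sup>+\<xi>. (\<integral>\<^sup>+r\<in>{0<..}.
              indicator B (r *\<^sub>R \<xi>) * ennreal (exp (r * f \<xi>) * (exp r - 1) powr (- (\<alpha> + 1)))
            \<partial>lborel) \<partial>\<sigma>)"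

text \<open>The values of \<open>f\<close> off the sphere are irrelevant.  \<open>bdd_above\<close> is needed because the real
  supremum of an unbounded set is unspecified.\<close>

definition lamperti_parameters :: "real \<Rightarrow> (real^'n \<Rightarrow> real) \<Rightarrow> (real^'n) measure \<Rightarrow> bool" where
  "lamperti_parameters \<alpha> f \<sigma> \<longleftrightarrow>
     0 < \<alpha> \<and> \<alpha> < 2 \<and>
     finite_measure \<sigma> \<and> sets \<sigma> = sets (restrict_space borel (sphere 0 1)) \<and>
     emeasure \<sigma> (space \<sigma>) \<noteq> 0 \<and>
     f \<in> borel_measurable (restrict_space borel (sphere 0 1)) \<and>
     bdd_above (f ` sphere 0 1) \<and> (SUP \<xi>\<in>sphere 0 1. f \<xi>) < \<alpha> + 1"

definition lamperti_stable ::
    "real \<Rightarrow> (real^'n \<Rightarrow> real) \<Rightarrow> (real^'n) measure \<Rightarrow> (real^'n) measure \<Rightarrow> bool" where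
  "lamperti_stable \<alpha> f \<sigma> \<mu> \<longleftrightarrow>
     lamperti_parameters \<alpha> f \<sigma> \<and> infinitely_divisible \<mu> \<and>
     (\<exists>b. has_generating_triplet \<mu> 0 (lamperti_levy \<alpha> f \<sigma>) b)"

lemma sets_lamperti_levy [simp, measurable_cong]:
  "sets (lamperti_levy \<alpha> f \<sigma> :: (real^'n) measure) = sets (restrict_space borel (- {0}))"
  unfolding lamperti_levy_def
  using sets.sets_measure_of_eq[where M = "restrict_space borel (- {0::real^'n})"]
  by (simp add: space_restrict_space del: sets.sets_measure_of_eq)

lemma emeasure_lamperti_levy:
  fixes \<sigma> :: "(real^'n) measure"
  assumes "lamperti_parameters \<alpha> f \<sigma>" and B: "B \<in> sets (restrict_space borel (- {0}))"
  shows "emeasure (lamperti_levy \<alpha> f \<sigma>) B =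
     (\<integral>\<^sup>+\<xi>. (\<integral>\<^sup>+r\<in>{0<..}.
        indicator B (r *\<^sub>R \<xi>) * ennreal (exp (r * f \<xi>) * (exp r - 1) powr (- (\<alpha> + 1)))
      \<partial>lborel) \<partial>\<sigma>)"
proof (rule emeasure_measure_of[OF lamperti_levy_def])
  have sets_\<sigma>: "sets \<sigma> = sets (restrict_space borel (sphere 0 1))"
    and f: "f \<in> borel_measurable (restrict_space borel (sphere 0 1))"
    and "finite_measure \<sigma>"
    using assms by (auto simp: lamperti_parameters_def)
  interpret \<sigma>: finite_measure \<sigma> by fact
  have f' [measurable]: "f \<in> borel_measurable \<sigma>"
    using f measurable_cong_sets[OF sets_\<sigma> refl] by blast
  have id [measurable]: "(\<lambda>x. x) \<in> \<sigma> \<rightarrow>\<^sub>M borel"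
    using measurable_cong_sets[OF sets_\<sigma> refl, of "borel :: (real^'n) measure"]
      measurable_restrict_space1[OF measurable_ident] by (auto simp: id_def)
  have in_borel: "C \<in> sets borel" if "C \<in> sets (restrict_space borel (- {0::real^'n}))" for C
    using that by (simp add: sets_restrict_space_iff)
  show "sets (restrict_space borel (- {0::real^'n})) \<subseteq> Pow (- {0})"
    using sets.sets_into_space[of _ "restrict_space borel (- {0::real^'n})"]
    by (auto simp: space_restrict_space)
  show "B \<in> sets (lamperti_levy \<alpha> f \<sigma>)"
    using B by simp
  let ?g = "\<lambda>B \<xi>. \<integral>\<^sup>+r\<in>{0<..}.
      indicator B (r *\<^sub>R \<xi>) * ennreal (exp (r * f \<xi>) * (exp r - 1) powr (- (\<alpha> + 1))) \<partial>lborel"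
  show "positive (sets (lamperti_levy \<alpha> f \<sigma>)) (\<lambda>B. \<integral>\<^sup>+\<xi>. ?g B \<xi> \<partial>\<sigma>)"
    by (simp add: positive_def)
  show "countably_additive (sets (lamperti_levy \<alpha> f \<sigma>)) (\<lambda>B. \<integral>\<^sup>+\<xi>. ?g B \<xi> \<partial>\<sigma>)"
  proof (rule countably_additiveI)
    fix C :: "nat \<Rightarrow> (real^'n) set"
    assume C: "range C \<subseteq> sets (lamperti_levy \<alpha> f \<sigma>)" and disj: "disjoint_family C"
    have C_borel [measurable]: "C i \<in> sets borel" for i
      using C in_borel by auto
    have "(\<Sum>i. \<integral>\<^sup>+\<xi>. ?g (C i) \<xi> \<partial>\<sigma>) = (\<integral>\<^sup>+\<xi>. (\<Sum>i. ?g (C i) \<xi>) \<partial>\<sigma>)"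
      by (rule nn_integral_suminf[symmetric]) measurable
    also have "\<dots> = (\<integral>\<^sup>+\<xi>. ?g (\<Union>i. C i) \<xi> \<partial>\<sigma>)"
    proof (rule nn_integral_cong)
      fix \<xi> assume "\<xi> \<in> space \<sigma>"
      have "(\<Sum>i. ?g (C i) \<xi>) = (\<integral>\<^sup>+r. (\<Sum>i. indicator (C i) (r *\<^sub>R \<xi>)
          * ennreal (exp (r * f \<xi>) * (exp r - 1) powr (- (\<alpha> + 1))) * indicator {0<..} r) \<partial>lborel)"
        by (rule nn_integral_suminf[symmetric]) measurable
      also have "\<dots> = ?g (\<Union>i. C i) \<xi>"
        by (simp only: ennreal_suminf_multc suminf_indicator[OF disj])
      finally show "(\<Sum>i. ?g (C i) \<xi>) = ?g (\<Union>i. C i) \<xi>" .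
    qed
    finally show "(\<Sum>i. \<integral>\<^sup>+\<xi>. ?g (C i) \<xi> \<partial>\<sigma>) = (\<integral>\<^sup>+\<xi>. ?g (\<Union>i. C i) \<xi> \<partial>\<sigma>)" .
  qed
qed

end

theory Submission
  imports Defs "HOL-Complex_Analysis.Laurent_Convergence" "HOL-Real_Asymp.Real_Asymp"
begin

text \<open>
  Let \<open>X\<close> and \<open>X'\<close> be independent with law \<open>\<mu>\<close>, and let \<open>\<nu>\<close> be the Levy measure.  The
  symmetrised projection \<open>Y = \<langle>z, X - X'\<rangle>\<close> has the real characteristic function
  \<open>E cos (t Y) = exp (2 \<integral> (cos (t \<langle>z, x\<rangle>) - 1) d\<nu>)\<close>, in which drift and truncation have
  disappeared.  Exponential moments of \<open>\<mu>\<close> are compared with exponential moments of \<open>\<nu>\<close>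
  through this formula alone, without uniqueness or continuity theorems for characteristic
  functions.

  If \<open>\<integral> (cosh (\<theta> \<parallel>x\<parallel>) - 1) d\<nu>\<close> is finite for \<open>\<theta> < R\<close>, then the exponent is a power series in
  \<open>- t\<^sup>2\<close>, whose coefficients \<open>2 \<integral> \<langle>z, x\<rangle>\<^sup>2\<^sup>k d\<nu> / (2k)!\<close> are nonnegative, and hence so is its
  exponential \<open>\<Sum> b\<^sub>k (- t\<^sup>2)\<^sup>k\<close>, whose coefficients dominate those of the exponent
  (\<open>exp_power_series_dominates\<close>).  A characteristic function that is such a power series near
  \<open>0\<close> determines the even moments, \<open>E Y\<^sup>2\<^sup>k = (2k)! b\<^sub>k\<close> (\<open>even_moments_of_cos_power_series\<close>).
  This gives two facts: \<open>E cosh (\<theta> Y)\<close> is finite for \<open>\<theta> < R\<close>, and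
  \<open>2 \<integral> \<langle>z, x\<rangle>\<^sup>2\<^sup>k d\<nu> \<le> E Y\<^sup>2\<^sup>k\<close>.

  The first fact gives the exponential moments of \<open>\<parallel>X\<parallel>\<close>: the norm is, up to a factor close to
  one, the maximum of finitely many projections (\<open>exp_norm_finite\<close>).  For a Lamperti stable law
  \<open>R = \<alpha> + 1 - \<gamma>\<close> is admissible, because the radial density decays at least like
  \<open>exp (- (\<alpha> + 1 - \<gamma>) r)\<close> (\<open>lamperti_levy_cosh_finite\<close>).  As \<open>R > 0\<close>, powers of the norm are
  dominated by one of these exponentials.

  The second fact gives the converse.  A single projection does not see the critical exponent:
  in high dimension \<open>E exp (c \<langle>z, X\<rangle>)\<close> can be finite when \<open>E exp (c \<parallel>X\<parallel>)\<close> is not.  But the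
  inequality between moments can be averaged over \<open>z\<close> with respect to a rotation invariant law,
  which turns \<open>\<langle>z, x\<rangle>\<^sup>2\<^sup>k\<close> into a multiple of \<open>\<parallel>x\<parallel>\<^sup>2\<^sup>k\<close> (\<open>norm_moment_ge\<close>), and summation over
  \<open>k\<close> bounds \<open>2 \<integral> (cosh (c \<parallel>x\<parallel>) - 1) d\<nu>\<close> by \<open>(E exp (c \<parallel>X\<parallel>))\<^sup>2\<close>
  (\<open>cosh_levy_integral_le\<close>).  If \<open>f\<close> is constant and \<open>c = \<alpha> + 1 - \<kappa>\<close>, the radial integrand on
  the left is bounded away from \<open>0\<close> at infinity, and \<open>\<sigma>\<close> is not zero, so the left-hand side is infinite
  (\<open>lamperti_levy_cosh_infinite\<close>).
\<close>

section \<open>The hyperbolic cosine\<close>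

lemma borel_measurable_cosh [measurable]: "cosh \<in> borel_measurable (borel :: real measure)"
  by (intro borel_measurable_continuous_onI continuous_intros)

lemma cosh_sums_even: "(\<lambda>k. y ^ (2 * k) / fact (2 * k)) sums cosh (y::real)"
proof -
  have "(\<lambda>n. \<Sum>k = n * 2..<n * 2 + 2. if even k then y ^ k /\<^sub>R fact k else 0) sums cosh y"
    by (rule sums_group[OF cosh_converges]) simp
  then show ?thesis
    by (simp add: mult.commute divide_inverse)
qed

lemma cos_sums_even: "(\<lambda>k. y ^ (2 * k) / fact (2 * k) * (-1) ^ k) sums cos (y::real)"
  using cos_paired[of y] by (simp add: mult_ac)

lemma cosh_le_cosh_of_abs_le:
  "\<bar>x\<bar> \<le> y \<Longrightarrow> cosh x \<le> cosh (y::real)"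
  using cosh_real_nonneg_le_iff[of "\<bar>x\<bar>" y] by auto

lemma exp_le_two_cosh: "exp x \<le> 2 * cosh (x::real)"
  by (simp add: cosh_field_def)

lemma cosh_le_exp: "0 \<le> u \<Longrightarrow> cosh u \<le> exp (u::real)"
  using cosh_plus_sinh[of u] sinh_real_nonneg_iff[of u] by linarith

text \<open>Near the origin the factor \<open>y\<^sup>2\<close> is what a Levy measure integrates; far away only the exponential
matters.\<close>

lemma cosh_minus_one_le:
  assumes \<theta>: "0 \<le> \<theta>" and y: "0 \<le> (y::real)"
  shows "cosh (\<theta> * y) - 1 \<le> cosh \<theta> * min 1 (y\<^sup>2) + exp (\<theta> * y) * indicator {1<..} y"
proof (cases "y \<le> 1")
  case True
  \<comment> \<open>For \<open>y \<le> 1\<close> every term of the series except the constant one contains the factor \<open>y\<^sup>2\<close>.\<close>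
  have "(\<theta> * y) ^ (2 * k) / fact (2 * k) - (if k = 0 then 1 else 0)
      \<le> y\<^sup>2 * (\<theta> ^ (2 * k) / fact (2 * k))" for k
  proof (cases "k = 0")
    case False
    then have "y ^ (2 * k) \<le> y\<^sup>2"
      using y True by (intro power_decreasing) auto
    then have "\<theta> ^ (2 * k) * y ^ (2 * k) / fact (2 * k) \<le> \<theta> ^ (2 * k) * y\<^sup>2 / fact (2 * k)"
      by (intro divide_right_mono mult_left_mono) auto
    then show ?thesis
      using False by (simp add: power_mult_distrib mult.commute)
  qed simp
  then have "cosh (\<theta> * y) - 1 \<le> y\<^sup>2 * cosh \<theta>"
    using sums_le[OF _ sums_diff[OF cosh_sums_even sums_single[of 0 "\<lambda>_. 1"]] sums_mult[OF cosh_sums_even]] by blast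
  moreover have "min 1 (y\<^sup>2) = y\<^sup>2" using power_le_one[OF y True, of 2] by simp
  ultimately show ?thesis using True by (simp add: mult.commute)
next
  case False
  have "cosh (\<theta> * y) \<le> exp (\<theta> * y)"
    using \<theta> y by (intro cosh_le_exp) simp
  moreover have "0 \<le> cosh \<theta> * min 1 (y\<^sup>2)"
    by (simp add: cosh_real_nonneg)
  ultimately have "cosh (\<theta> * y) - 1 \<le> cosh \<theta> * min 1 (y\<^sup>2) + exp (\<theta> * y)"
    by linarith
  then show ?thesis using False by simp
qed

lemma cosh_minus_one_ge:
  assumes "0 \<le> c" "c \<le> u"
  shows "(1 - exp (- c))\<^sup>2 / 2 * exp u \<le> cosh u - (1::real)"
proof -
  have "cosh u - 1 = (1 - exp (- u))\<^sup>2 / 2 * exp u"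
  proof -
    have "exp u * exp (- u) = 1" by (simp flip: exp_add)
    moreover have "(1 - exp (- u))\<^sup>2 * exp u
        = exp u - 2 * (exp u * exp (- u)) + (exp u * exp (- u)) * exp (- u)"
      by (simp only: power2_eq_square) (simp only: algebra_simps)
    ultimately show ?thesis by (simp add: cosh_field_def field_simps)
  qed
  moreover have "(1 - exp (- c))\<^sup>2 \<le> (1 - exp (- u))\<^sup>2"
    using assms by (intro power_mono) auto
  ultimately show ?thesis by (simp add: mult_right_mono)
qed

section \<open>Taylor remainders of the cosine\<close>

text \<open>The sign makes the remainder nonnegative for \<open>k \<ge> 1\<close>: the partial sums of the Taylor series lie
alternately above and below the cosine.\<close>

definition cos_remainder :: "nat \<Rightarrow> real \<Rightarrow> real" where
  "cos_remainder k u = (-1) ^ k * (cos u - (\<Sum>j<k. (- (u\<^sup>2)) ^ j / fact (2 * j)))"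

lemma cos_remainder_add_Suc:
  "cos_remainder k u + cos_remainder (Suc k) u = u ^ (2 * k) / fact (2 * k)"
proof -
  have "(-1) ^ k * (- (u\<^sup>2)) ^ k = u ^ (2 * k)"
    by (simp add: power_mult flip: power_mult_distrib)
  then show ?thesis
    by (simp add: cos_remainder_def right_diff_distrib distrib_left)
qed

lemma abs_cos_remainder_le: "\<bar>cos_remainder k u\<bar> \<le> u ^ (2 * k) / fact (2 * k)"
proof -
  have sum_eq: "(\<Sum>m<2 * k. cos_coeff m * u ^ m) = (\<Sum>j<k. (- (u\<^sup>2)) ^ j / fact (2 * j))"
  proof (induction k)
    case (Suc k)
    have "(- (u\<^sup>2)) ^ k = (-1) ^ k * u ^ (2 * k)"
      by (subst power_minus) (simp add: power_mult)
    then show ?case using Suc by (simp add: cos_coeff_def)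
  qed simp
  obtain t where "cos u = (\<Sum>m<2 * k. cos_coeff m * u ^ m)
      + (cos (t + 1 / 2 * real (2 * k) * pi) / fact (2 * k)) * u ^ (2 * k)"
    using Maclaurin_cos_expansion by blast
  then have "\<bar>cos_remainder k u\<bar> = \<bar>cos (t + 1 / 2 * real (2 * k) * pi)\<bar> * (u ^ (2 * k) / fact (2 * k))"
    by (simp add: cos_remainder_def sum_eq abs_mult power_even_abs)
  also have "\<dots> \<le> 1 * (u ^ (2 * k) / fact (2 * k))"
    by (intro mult_right_mono) auto
  finally show ?thesis by simp
qed

text \<open>Two consecutive remainders add up to the term \<open>u\<^sup>2\<^sup>i / (2i)!\<close>, which already bounds the absolute value
of the first, so the second cannot be negative.  The cosine itself, \<open>k = 0\<close>, has to be excluded.\<close>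

lemma cos_remainder_nonneg:
  assumes "k \<ge> 1"
  shows "0 \<le> cos_remainder k u"
proof -
  obtain i where k: "k = Suc i"
    using assms not0_implies_Suc by force
  show ?thesis
    using cos_remainder_add_Suc[of i u] abs_cos_remainder_le[of i u] unfolding k by linarith
qed

lemma cos_remainder_le: "cos_remainder k u \<le> u ^ (2 * k) / fact (2 * k)"
  using abs_cos_remainder_le[of k u] by linarith

lemma cos_remainder_asymptotics:
  assumes t: "t \<longlonglongrightarrow> 0" "\<And>n. t n \<noteq> 0"
  shows "(\<lambda>n. cos_remainder k (t n * y) / t n ^ (2 * k)) \<longlonglongrightarrow> y ^ (2 * k) / fact (2 * k)"
proof (rule LIM_zero_cancel, rule Lim_null_comparison)
  have "\<bar>cos_remainder k (t n * y) / t n ^ (2 * k) - y ^ (2 * k) / fact (2 * k)\<bar>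
      \<le> (t n)\<^sup>2 * (y ^ (2 * k + 2) / fact (2 * k + 2))" for n
  proof -
    have "cos_remainder k (t n * y) / t n ^ (2 * k) - y ^ (2 * k) / fact (2 * k)
        = - (cos_remainder (Suc k) (t n * y) / t n ^ (2 * k))"
    proof -
      have "cos_remainder k (t n * y) = t n ^ (2 * k) * (y ^ (2 * k) / fact (2 * k))
          - cos_remainder (Suc k) (t n * y)"
        using cos_remainder_add_Suc[of k "t n * y"] by (simp add: power_mult_distrib)
      then show ?thesis using t(2)[of n] by (simp add: diff_divide_distrib)
    qed
    then have "\<bar>cos_remainder k (t n * y) / t n ^ (2 * k) - y ^ (2 * k) / fact (2 * k)\<bar>
        = \<bar>cos_remainder (Suc k) (t n * y)\<bar> / t n ^ (2 * k)"
      by (simp add: abs_divide power_even_abs)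
    also have "\<dots> \<le> ((t n * y) ^ (2 * Suc k) / fact (2 * Suc k)) / t n ^ (2 * k)"
      by (intro divide_right_mono abs_cos_remainder_le) simp
    also have "(t n * y) ^ (2 * Suc k) = t n ^ (2 * k) * ((t n)\<^sup>2 * y ^ (2 * k + 2))"
      by (simp add: power_mult_distrib power2_eq_square)
    also have "t n ^ (2 * k) * ((t n)\<^sup>2 * y ^ (2 * k + 2)) / fact (2 * Suc k) / t n ^ (2 * k)
        = (t n)\<^sup>2 * (y ^ (2 * k + 2) / fact (2 * k + 2))"
      using t(2)[of n] by (simp del: fact_Suc)
    finally show ?thesis .
  qed
  then show "\<forall>\<^sub>F n in sequentially. norm (cos_remainder k (t n * y) / t n ^ (2 * k) - y ^ (2 * k) / fact (2 * k))
      \<le> (t n)\<^sup>2 * (y ^ (2 * k + 2) / fact (2 * k + 2))"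
    by simp
  show "(\<lambda>n. (t n)\<^sup>2 * (y ^ (2 * k + 2) / fact (2 * k + 2))) \<longlonglongrightarrow> 0"
    using tendsto_mult_left_zero[OF tendsto_null_power[OF t(1)], of 2] by simp
qed

lemma borel_measurable_cos_remainder [measurable]: "cos_remainder k \<in> borel_measurable borel"
  unfolding cos_remainder_def by measurable

section \<open>Even moments from a power series of the characteristic function\<close>

text \<open>The moments are not assumed to exist; they are found one after the other.  Once the moments below
\<open>2k\<close> are known, the expectation of the \<open>k\<close>-th cosine remainder at \<open>t Y\<close> is \<open>t\<^sup>2\<^sup>k\<close> times the tail
\<open>g (- t\<^sup>2) = b\<^sub>k - b\<^sub>k\<^sub>+\<^sub>1 t\<^sup>2 + \<dots>\<close> of the series.  Divided by \<open>t\<^sup>2\<^sup>k\<close>, the remainder is nonnegative, at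
most \<open>Y\<^sup>2\<^sup>k / (2k)!\<close>, and tends to this bound as \<open>t \<rightarrow> 0\<close>.  Hence Fatou's lemma gives
\<open>E Y\<^sup>2\<^sup>k \<le> (2k)! b\<^sub>k\<close>, and the bound gives the opposite inequality.\<close>

lemma (in prob_space) even_moments_of_cos_power_series:
  fixes Y :: "'a \<Rightarrow> real" and b :: "nat \<Rightarrow> real"
  assumes Y [measurable]: "Y \<in> borel_measurable M" and R: "0 < R"
    and sums: "\<And>t. \<bar>t\<bar> < R \<Longrightarrow>
      (\<lambda>k. b k * (- (t\<^sup>2)) ^ k) sums expectation (\<lambda>\<omega>. cos (t * Y \<omega>))"
  shows "integrable M (\<lambda>\<omega>. Y \<omega> ^ (2 * k)) \<and> expectation (\<lambda>\<omega>. Y \<omega> ^ (2 * k)) = fact (2 * k) * b k"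
proof (induction k rule: less_induct)
  case (less k)
  show ?case
  proof (cases "k = 0")
    case True
    have "b 0 = expectation (\<lambda>\<omega>. cos (0 * Y \<omega>))"
      using sums[of 0] R powser_sums_zero[of b] sums_unique2 by fastforce
    then show ?thesis using True by (simp add: prob_space)
  next
    case False
    then have k: "k \<ge> 1" by simp
    have int_cos: "integrable M (\<lambda>\<omega>. cos (t * Y \<omega>))" for t
      by (rule integrable_const_bound[of _ 1]) auto
    define g where "g x = (\<Sum>n. b (n + k) * x ^ n)" for x
    have int_rem: "integrable M (\<lambda>\<omega>. cos_remainder k (t * Y \<omega>))" for t
    proof -
      have "integrable M (\<lambda>\<omega>. (- ((t * Y \<omega>)\<^sup>2)) ^ j / fact (2 * j))" if "j < k" for j
      proof -
        have "(- ((t * Y \<omega>)\<^sup>2)) ^ j = (- (t\<^sup>2)) ^ j * Y \<omega> ^ (2 * j)" for \<omega>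
          by (simp add: power_mult flip: power_mult_distrib)
        then show ?thesis using less[OF that] by simp
      qed
      then show ?thesis unfolding cos_remainder_def
        using int_cos by (intro integrable_mult_right Bochner_Integration.integrable_diff
            Bochner_Integration.integrable_sum) auto
    qed
    have exp_rem: "expectation (\<lambda>\<omega>. cos_remainder k (t * Y \<omega>)) = t ^ (2 * k) * g (- (t\<^sup>2))"
      if t: "\<bar>t\<bar> < R" "t \<noteq> 0" for t
    proof -
      have moment: "integrable M (\<lambda>\<omega>. (- ((t * Y \<omega>)\<^sup>2)) ^ j / fact (2 * j)) \<and>
          expectation (\<lambda>\<omega>. (- ((t * Y \<omega>)\<^sup>2)) ^ j / fact (2 * j)) = b j * (- (t\<^sup>2)) ^ j"
        if "j < k" for j
      proof -
        have "(- ((t * Y \<omega>)\<^sup>2)) ^ j = (- (t\<^sup>2)) ^ j * Y \<omega> ^ (2 * j)" for \<omega>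
          by (simp add: power_mult flip: power_mult_distrib)
        then show ?thesis using less[OF that] by simp
      qed
      have "expectation (\<lambda>\<omega>. cos_remainder k (t * Y \<omega>))
          = (-1) ^ k * (expectation (\<lambda>\<omega>. cos (t * Y \<omega>)) - (\<Sum>j<k. b j * (- (t\<^sup>2)) ^ j))"
      proof -
        have "integrable M (\<lambda>\<omega>. \<Sum>j<k. (- ((t * Y \<omega>)\<^sup>2)) ^ j / fact (2 * j))"
          using moment by (intro Bochner_Integration.integrable_sum) simp
        moreover have "expectation (\<lambda>\<omega>. \<Sum>j<k. (- ((t * Y \<omega>)\<^sup>2)) ^ j / fact (2 * j))
            = (\<Sum>j<k. b j * (- (t\<^sup>2)) ^ j)"
          using moment by (subst Bochner_Integration.integral_sum) simp_all
        ultimately show ?thesis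
          using int_cos unfolding cos_remainder_def by simp
      qed
      moreover have "(\<lambda>n. b (n + k) * (- (t\<^sup>2)) ^ (n + k))
          sums (expectation (\<lambda>\<omega>. cos (t * Y \<omega>)) - (\<Sum>j<k. b j * (- (t\<^sup>2)) ^ j))"
        using sums_split_initial_segment[OF sums[OF t(1)]] .
      then have "(\<lambda>n. (b (n + k) * (- (t\<^sup>2)) ^ (n + k)) / (- (t\<^sup>2)) ^ k)
          sums ((expectation (\<lambda>\<omega>. cos (t * Y \<omega>)) - (\<Sum>j<k. b j * (- (t\<^sup>2)) ^ j)) / (- (t\<^sup>2)) ^ k)"
        by (rule sums_divide)
      then have "(\<lambda>n. b (n + k) * (- (t\<^sup>2)) ^ n)
          sums ((expectation (\<lambda>\<omega>. cos (t * Y \<omega>)) - (\<Sum>j<k. b j * (- (t\<^sup>2)) ^ j)) / (- (t\<^sup>2)) ^ k)"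
        using t by (simp add: power_add)
      then have "g (- (t\<^sup>2))
          = (expectation (\<lambda>\<omega>. cos (t * Y \<omega>)) - (\<Sum>j<k. b j * (- (t\<^sup>2)) ^ j)) / (- (t\<^sup>2)) ^ k"
        unfolding g_def by (rule sums_unique[symmetric])
      moreover have "(-1) ^ k * (- (t\<^sup>2)) ^ k = t ^ (2 * k)"
        by (simp add: power_mult flip: power_mult_distrib)
      moreover have "(- (t\<^sup>2)) ^ k \<noteq> 0" using t by simp
      ultimately show ?thesis
        by (metis (no_types, lifting) mult.assoc nonzero_mult_div_cancel_left times_divide_eq_right)
    qed
    \<comment> \<open>Convergence at the negative point \<open>- (R / 2)\<^sup>2\<close> gives convergence on a disc around \<open>0\<close>.\<close>
    have lim_g: "(g \<longlongrightarrow> b k) (at 0)"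
    proof -
      let ?s = "(R / 2)\<^sup>2"
      have "(g \<longlongrightarrow> b (0 + k)) (at 0)"
      proof (rule powser_limit_0_strong)
        show "0 < ?s" using R by simp
        fix x :: real assume x: "x \<noteq> 0" "norm x < ?s"
        have "summable (\<lambda>n. b n * (- ?s) ^ n)"
          using sums[of "R / 2"] R by (auto simp: sums_iff)
        then have "summable (\<lambda>n. b n * x ^ n)"
          by (rule powser_inside) (use x in auto)
        then have "summable (\<lambda>n. b (n + k) * x ^ (n + k))"
          by (rule summable_ignore_initial_segment)
        then have "summable (\<lambda>n. b (n + k) * x ^ (n + k) / x ^ k)"
          by (rule summable_divide)
        then show "(\<lambda>n. b (n + k) * x ^ n) sums g x"
          using x unfolding g_def by (simp add: power_add summable_sums)
      qed
      then show ?thesis by simp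
    qed
    define t where "t n = (R / 2) / real (Suc n)" for n
    have t_pos: "0 < t n" and t_less: "\<bar>t n\<bar> < R" for n
    proof -
      show "0 < t n" using R by (simp add: t_def)
      have "t n \<le> R / 2" using R by (simp add: t_def field_simps)
      then show "\<bar>t n\<bar> < R" using R \<open>0 < t n\<close> by simp
    qed
    have t_lim: "t \<longlonglongrightarrow> 0"
      unfolding t_def by (rule LIMSEQ_Suc) (rule lim_const_over_n)
    have t_nz: "t n \<noteq> 0" for n using t_pos[of n] by simp
    have lim_gt: "(\<lambda>n. g (- ((t n)\<^sup>2))) \<longlonglongrightarrow> b k"
    proof -
      have "filterlim (\<lambda>n. - ((t n)\<^sup>2)) (at 0) sequentially"
        unfolding filterlim_at using t_nz tendsto_minus[OF tendsto_null_power[OF t_lim, of 2]] by simp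
      from filterlim_compose[OF lim_g this] show ?thesis .
    qed
    have "(\<integral>\<^sup>+\<omega>. ennreal (Y \<omega> ^ (2 * k) / fact (2 * k)) \<partial>M)
        = (\<integral>\<^sup>+\<omega>. liminf (\<lambda>n. ennreal (cos_remainder k (t n * Y \<omega>) / t n ^ (2 * k))) \<partial>M)"
      by (intro nn_integral_cong lim_imp_Liminf[symmetric] tendsto_ennrealI
          cos_remainder_asymptotics t_lim t_nz) simp
    also have "\<dots> \<le> liminf (\<lambda>n. \<integral>\<^sup>+\<omega>. ennreal (cos_remainder k (t n * Y \<omega>) / t n ^ (2 * k)) \<partial>M)"
      by (rule nn_integral_liminf) measurable
    also have "\<dots> = liminf (\<lambda>n. ennreal (g (- ((t n)\<^sup>2))))"
    proof -
      have "(\<integral>\<^sup>+\<omega>. ennreal (cos_remainder k (t n * Y \<omega>) / t n ^ (2 * k)) \<partial>M)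
          = ennreal (g (- ((t n)\<^sup>2)))" for n
      proof -
        have "(\<integral>\<^sup>+\<omega>. ennreal (cos_remainder k (t n * Y \<omega>) / t n ^ (2 * k)) \<partial>M)
            = ennreal (expectation (\<lambda>\<omega>. cos_remainder k (t n * Y \<omega>) / t n ^ (2 * k)))"
          using int_rem k t_pos[of n]
          by (intro nn_integral_eq_integral) (auto intro!: divide_nonneg_nonneg cos_remainder_nonneg)
        then show ?thesis using exp_rem[OF t_less t_nz, of n] t_nz[of n] by simp
      qed
      then show ?thesis by simp
    qed
    also have "\<dots> = ennreal (b k)"
      by (intro lim_imp_Liminf tendsto_ennrealI lim_gt) simp
    finally have upper: "(\<integral>\<^sup>+\<omega>. ennreal (Y \<omega> ^ (2 * k) / fact (2 * k)) \<partial>M) \<le> ennreal (b k)" .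
    then have int_div: "integrable M (\<lambda>\<omega>. Y \<omega> ^ (2 * k) / fact (2 * k))"
      by (intro integrableI_nonneg) (auto intro: order_le_less_trans)
    then have "integrable M (\<lambda>\<omega>. fact (2 * k) * (Y \<omega> ^ (2 * k) / fact (2 * k)))"
      by (intro integrable_mult_right)
    then have int_pow: "integrable M (\<lambda>\<omega>. Y \<omega> ^ (2 * k))"
      by simp
    have b_le: "b k \<le> expectation (\<lambda>\<omega>. Y \<omega> ^ (2 * k) / fact (2 * k))"
    proof (rule LIMSEQ_le_const2[OF lim_gt], intro exI allI impI)
      fix n
      have "t n ^ (2 * k) * g (- ((t n)\<^sup>2)) = expectation (\<lambda>\<omega>. cos_remainder k (t n * Y \<omega>))"
        using exp_rem[OF t_less t_nz] by simp
      also have "\<dots> \<le> expectation (\<lambda>\<omega>. t n ^ (2 * k) * (Y \<omega> ^ (2 * k) / fact (2 * k)))"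
        using cos_remainder_le[of k "t n * Y _"] int_div
        by (intro integral_mono int_rem integrable_mult_right) (simp_all add: power_mult_distrib)
      finally have "t n ^ (2 * k) * g (- ((t n)\<^sup>2))
          \<le> t n ^ (2 * k) * expectation (\<lambda>\<omega>. Y \<omega> ^ (2 * k) / fact (2 * k))"
        by (simp add: int_div)
      then show "g (- ((t n)\<^sup>2)) \<le> expectation (\<lambda>\<omega>. Y \<omega> ^ (2 * k) / fact (2 * k))"
        using t_pos[of n] by (subst (asm) mult_le_cancel_left_pos) auto
    qed
    have nonneg: "0 \<le> expectation (\<lambda>\<omega>. Y \<omega> ^ (2 * k) / fact (2 * k))"
      by (intro Bochner_Integration.integral_nonneg) simp
    have b_nonneg: "0 \<le> b k"
    proof (rule LIMSEQ_le_const[OF lim_gt], intro exI allI impI)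
      fix n
      have "0 \<le> expectation (\<lambda>\<omega>. cos_remainder k (t n * Y \<omega>))"
        using k by (intro Bochner_Integration.integral_nonneg cos_remainder_nonneg)
      then show "0 \<le> g (- ((t n)\<^sup>2))"
        using exp_rem[OF t_less t_nz, of n] zero_less_power[OF t_pos[of n], of "2 * k"]
        by (simp add: zero_le_mult_iff)
    qed
    have "ennreal (expectation (\<lambda>\<omega>. Y \<omega> ^ (2 * k) / fact (2 * k))) \<le> ennreal (b k)"
      using upper nn_integral_eq_integral[OF int_div] by simp
    then have "expectation (\<lambda>\<omega>. Y \<omega> ^ (2 * k) / fact (2 * k)) = b k"
      using b_le b_nonneg by (simp add: ennreal_le_iff)
    then show ?thesis using int_pow by (simp add: field_simps)
  qed
qed

text \<open>Formally the coefficients of \<open>exp A = \<Sum> A\<^sup>i / i!\<close> are sums of products of the nonnegative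
coefficients of \<open>A\<close>, and the summand \<open>i = 1\<close> is \<open>A\<close> itself.  That this formal series converges on
the whole disc where \<open>A\<close> does is seen in the complex plane: there \<open>exp A\<close> is holomorphic on that
disc, and it is the sum of its Taylor series.\<close>

lemma exp_power_series_dominates:
  fixes a :: "nat \<Rightarrow> real"
  assumes a0: "a 0 = 0" and a_nonneg: "\<And>k. 0 \<le> a k"
    and summable: "\<And>s. 0 < s \<Longrightarrow> s < r \<Longrightarrow> summable (\<lambda>k. a k * s ^ k)" and r: "0 < r"
  obtains b where "\<And>k. 0 \<le> b k" "\<And>k. a k \<le> b k"
    "\<And>s. \<bar>s\<bar> < r \<Longrightarrow> (\<lambda>k. b k * s ^ k) sums exp (\<Sum>k. a k * s ^ k)"
proof -
  define A :: "complex fps" where "A = Abs_fps (\<lambda>k. of_real (a k))"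
  define B where "B = fps_exp 1 oo A"
  have sum_nonneg_Reals: "sum f I \<in> \<real>\<^sub>\<ge>\<^sub>0" if "\<And>i. i \<in> I \<Longrightarrow> f i \<in> \<real>\<^sub>\<ge>\<^sub>0"
    for f :: "nat \<Rightarrow> complex" and I
    using that by (induction I rule: infinite_finite_induct) auto
  have nth_pow: "fps_nth (A ^ i) k \<in> \<real>\<^sub>\<ge>\<^sub>0" for i k
  proof (induction i arbitrary: k)
    case (Suc i)
    then show ?case
      using a_nonneg by (auto simp: fps_mult_nth A_def intro!: sum_nonneg_Reals nonneg_Reals_mult_I)
  qed (auto simp: fps_one_def)
  have B_nth: "fps_nth B k = (\<Sum>i=0..k. fps_nth (A ^ i) k / fact i)" for k
    by (simp add: B_def fps_compose_nth)
  have fact_div: "z / fact i \<in> \<real>\<^sub>\<ge>\<^sub>0" if "z \<in> \<real>\<^sub>\<ge>\<^sub>0" for z :: complex and i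
    using that nonneg_Reals_of_nat_I[of "fact i"]
    by (intro nonneg_Reals_divide_I) simp_all
  have B_real: "fps_nth B k \<in> \<real>\<^sub>\<ge>\<^sub>0" for k
    unfolding B_nth by (intro sum_nonneg_Reals fact_div nth_pow)
  have B_ge: "fps_nth B k - of_real (a k) \<in> \<real>\<^sub>\<ge>\<^sub>0" for k
  proof (cases "k = 0")
    case True
    then show ?thesis using B_real[of 0] a0 by simp
  next
    case False
    then have "fps_nth B k = fps_nth A k + (\<Sum>i\<in>{0..k} - {1}. fps_nth (A ^ i) k / fact i)"
      unfolding B_nth by (subst sum.remove[of _ 1]) auto
    then have "fps_nth B k - of_real (a k) = (\<Sum>i\<in>{0..k} - {1}. fps_nth (A ^ i) k / fact i)"
      by (simp add: A_def)
    also have "\<dots> \<in> \<real>\<^sub>\<ge>\<^sub>0"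
      by (intro sum_nonneg_Reals fact_div nth_pow)
    finally show ?thesis .
  qed
  have radius_A: "fps_conv_radius A \<ge> ereal r"
    unfolding fps_conv_radius_def
  proof (rule conv_radius_geI_ex)
    fix s :: real assume s: "0 < s" "ereal s < ereal r"
    then have "summable (\<lambda>k. complex_of_real (a k * s ^ k))"
      using summable by (simp only: summable_complex_of_real) simp
    then show "\<exists>z. norm z = s \<and> summable (\<lambda>n. fps_nth A n * z ^ n)"
      using s by (intro exI[of _ "complex_of_real s"]) (simp add: A_def)
  qed
  have "eval_fps A has_fps_expansion A"
    using less_le_trans[OF _ radius_A, of 0] r
    by (intro eval_fps_has_fps_expansion) (simp add: zero_ereal_def)
  then have expansion: "(exp \<circ> eval_fps A) has_fps_expansion B"
    unfolding B_def by (intro has_fps_expansion_compose has_fps_expansion_exp1) (simp_all add: A_def a0)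
  have holo: "(exp \<circ> eval_fps A) holomorphic_on eball 0 (ereal r)"
  proof -
    have "ereal (norm z) < fps_conv_radius A" if "norm z < r" for z :: complex
      using less_le_trans[OF _ radius_A, of "ereal (norm z)"] that by simp
    then show ?thesis
      unfolding o_def by (intro holomorphic_intros) (auto simp: in_eball_iff)
  qed
  have radius_B: "fps_conv_radius B \<ge> ereal r"
    using holomorphic_on_imp_fps_conv_radius_ge[OF expansion holo] .
  have B_eq: "fps_expansion (exp \<circ> eval_fps A) 0 = B"
    using fps_expansion_eqI[OF expansion] .
  show thesis
  proof (rule that[of "\<lambda>k. Re (fps_nth B k)"])
    show "0 \<le> Re (fps_nth B k)" for k
      using B_real[of k] by (simp add: complex_nonneg_Reals_iff)
    show "a k \<le> Re (fps_nth B k)" for k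
      using B_ge[of k] by (simp add: complex_nonneg_Reals_iff)
    fix s :: real assume s: "\<bar>s\<bar> < r"
    have s_A: "ereal (norm (complex_of_real s)) < fps_conv_radius A"
      and s_B: "ereal (norm (complex_of_real s)) < fps_conv_radius B"
      using s radius_A radius_B by (auto intro: less_le_trans[of _ "ereal r"])
    have "(\<lambda>k. fps_nth A k * of_real s ^ k) sums eval_fps A (of_real s)"
      by (rule sums_eval_fps[OF s_A])
    then have "(\<lambda>k. complex_of_real (a k * s ^ k)) sums eval_fps A (of_real s)"
      by (simp add: A_def)
    then have A_s: "eval_fps A (of_real s) = of_real (\<Sum>k. a k * s ^ k)"
      by (metis sums_summable summable_complex_of_real suminf_of_real sums_unique)
    have "(\<lambda>k. fps_nth B k * of_real s ^ k) sums eval_fps B (of_real s)"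
      by (rule sums_eval_fps[OF s_B])
    moreover have "eval_fps B (of_real s) = (exp \<circ> eval_fps A) (of_real s)"
      using eval_fps_expansion'[OF holo, of "of_real s"] s by (simp add: B_eq)
    ultimately have "(\<lambda>k. fps_nth B k * of_real s ^ k) sums exp (eval_fps A (of_real s))"
      by simp
    then have "(\<lambda>k. Re (fps_nth B k * of_real s ^ k)) sums Re (exp (eval_fps A (of_real s)))"
      by (rule sums_Re)
    then show "(\<lambda>k. Re (fps_nth B k) * s ^ k) sums exp (\<Sum>k. a k * s ^ k)"
      by (simp add: A_s exp_of_real flip: of_real_power)
  qed
qed

text \<open>The integral in the exponent is the power series in \<open>- t\<^sup>2\<close> with coefficients
\<open>a\<^sub>k = c \<integral> g\<^sup>2\<^sup>k dm / (2k)!\<close> for \<open>k \<ge> 1\<close>, and the assumption on the hyperbolic cosine is its absolute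
convergence.  So the two preceding lemmas apply and identify \<open>E Y\<^sup>2\<^sup>k / (2k)!\<close> as a coefficient
\<open>b\<^sub>k \<ge> a\<^sub>k\<close>; the series of the \<open>b\<^sub>k\<close> at \<open>\<theta>\<^sup>2\<close> is \<open>E cosh (\<theta> Y)\<close>.\<close>

lemma (in prob_space) even_moments_of_exp_cos_integral:
  fixes Y :: "'a \<Rightarrow> real" and g :: "'b \<Rightarrow> real" and m :: "'b measure" and c R :: real
  assumes Y [measurable]: "Y \<in> borel_measurable M" and g [measurable]: "g \<in> borel_measurable m"
    and R: "0 < R" and c: "0 \<le> c"
    and finite: "\<And>\<theta>. 0 < \<theta> \<Longrightarrow> \<theta> < R \<Longrightarrow> (\<integral>\<^sup>+x. ennreal (cosh (\<theta> * g x) - 1) \<partial>m) < \<infinity>"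
    and char: "\<And>t. \<bar>t\<bar> < R \<Longrightarrow>
      expectation (\<lambda>\<omega>. cos (t * Y \<omega>)) = exp (c * (LINT x|m. cos (t * g x) - 1))"
  shows nn_integral_cosh_finite:
      "\<And>\<theta>. \<bar>\<theta>\<bar> < R \<Longrightarrow> (\<integral>\<^sup>+\<omega>. ennreal (cosh (\<theta> * Y \<omega>)) \<partial>M) < \<infinity>"
    and even_moment_ge:
      "\<And>k. k \<ge> 1 \<Longrightarrow> ennreal c * (\<integral>\<^sup>+x. ennreal (g x ^ (2 * k)) \<partial>m)
        \<le> (\<integral>\<^sup>+\<omega>. ennreal (Y \<omega> ^ (2 * k)) \<partial>M)"
proof -
  define e where "e k x = (if k = 0 then 0 else g x ^ (2 * k) / fact (2 * k))" for k :: nat and x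
  define a where "a k = c * (LINT x|m. e k x)" for k
  have e_measurable [measurable]: "e k \<in> borel_measurable m" for k
    unfolding e_def by measurable
  have e_nonneg: "0 \<le> e k x" for k x by (simp add: e_def)
  have e_power: "e k x * (\<theta>\<^sup>2) ^ k = (\<theta> * g x) ^ (2 * k) / fact (2 * k) - (if k = 0 then 1 else 0)"
    for k x and \<theta> :: real
    by (simp add: e_def power_mult_distrib mult_ac flip: power_mult)
  have cosh_sums: "(\<lambda>k. e k x * (\<theta>\<^sup>2) ^ k) sums (cosh (\<theta> * g x) - 1)" for x and \<theta> :: real
    unfolding e_power using sums_diff[OF cosh_sums_even sums_single[of 0 "\<lambda>_. 1"]] by simp
  have partial_sum_le: "(\<Sum>k\<in>I. e k x * (\<theta>\<^sup>2) ^ k) \<le> cosh (\<theta> * g x) - 1"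
    if "finite I" for I x and \<theta> :: real
  proof (subst sums_unique[OF cosh_sums], rule sum_le_suminf)
    show "summable (\<lambda>k. e k x * (\<theta>\<^sup>2) ^ k)"
      using cosh_sums by (rule sums_summable)
  qed (use that e_nonneg in auto)
  have cos_sums: "(\<lambda>k. e k x * (- (\<theta>\<^sup>2)) ^ k) sums (cos (\<theta> * g x) - 1)" for x and \<theta> :: real
  proof -
    have "e k x * (- (\<theta>\<^sup>2)) ^ k
        = (\<theta> * g x) ^ (2 * k) / fact (2 * k) * (-1) ^ k - (if k = 0 then 1 else 0)" for k
    proof -
      have "e k x * (- (\<theta>\<^sup>2)) ^ k = (e k x * (\<theta>\<^sup>2) ^ k) * (-1) ^ k"
        by (subst power_minus) simp
      then show ?thesis unfolding e_power by (cases "k = 0") simp_all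
    qed
    then show ?thesis
      using sums_diff[OF cos_sums_even sums_single[of 0 "\<lambda>_. 1"]] by simp
  qed
  have int_cosh: "integrable m (\<lambda>x. cosh (\<theta> * g x) - 1)" if "0 < \<theta>" "\<theta> < R" for \<theta>
    using finite[OF that] cosh_real_ge_1 by (intro integrableI_nonneg) auto
  have int_e: "integrable m (e k)" for k
  proof -
    have "integrable m (\<lambda>x. e k x * ((R / 2)\<^sup>2) ^ k)"
    proof (rule Bochner_Integration.integrable_bound[OF int_cosh[of "R / 2"]])
      have "e k x * ((R / 2)\<^sup>2) ^ k \<le> cosh (R / 2 * g x) - 1" for x
        using partial_sum_le[of "{k}" x "R / 2"] by simp
      then show "AE x in m. norm (e k x * ((R / 2)\<^sup>2) ^ k) \<le> norm (cosh (R / 2 * g x) - 1)"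
        using e_nonneg cosh_real_ge_1 by (intro AE_I2) (simp add: abs_mult)
    qed (use R in auto)
    then show ?thesis using R by simp
  qed
  have summable_e: "summable (\<lambda>k. (LINT x|m. e k x) * (\<theta>\<^sup>2) ^ k)" if \<theta>: "0 < \<theta>" "\<theta> < R" for \<theta>
  proof (rule summableI_nonneg_bounded)
    show "0 \<le> (LINT x|m. e k x) * (\<theta>\<^sup>2) ^ k" for k
      by (intro mult_nonneg_nonneg Bochner_Integration.integral_nonneg e_nonneg) simp
    fix n
    have "(\<Sum>k<n. (LINT x|m. e k x) * (\<theta>\<^sup>2) ^ k) = (LINT x|m. (\<Sum>k<n. e k x * (\<theta>\<^sup>2) ^ k))"
      using int_e by (simp add: Bochner_Integration.integral_sum)
    also have "\<dots> \<le> (LINT x|m. cosh (\<theta> * g x) - 1)"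
    proof (rule integral_mono)
      show "integrable m (\<lambda>x. \<Sum>k<n. e k x * (\<theta>\<^sup>2) ^ k)" using int_e by simp
      show "(\<Sum>k<n. e k x * (\<theta>\<^sup>2) ^ k) \<le> cosh (\<theta> * g x) - 1" for x
        by (rule partial_sum_le) simp
    qed (rule int_cosh[OF \<theta>])
    finally show "(\<Sum>k<n. (LINT x|m. e k x) * (\<theta>\<^sup>2) ^ k) \<le> (LINT x|m. cosh (\<theta> * g x) - 1)" .
  qed
  have sums_cos: "(\<lambda>k. (LINT x|m. e k x) * (- (t\<^sup>2)) ^ k) sums (LINT x|m. cos (t * g x) - 1)"
    if t: "\<bar>t\<bar> < R" for t
  proof -
    have "(\<lambda>k. LINT x|m. e k x * (- (t\<^sup>2)) ^ k) sums (LINT x|m. (\<Sum>k. e k x * (- (t\<^sup>2)) ^ k))"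
    proof (rule sums_integral)
      show "integrable m (\<lambda>x. e k x * (- (t\<^sup>2)) ^ k)" for k
        using int_e by simp
      have norm_eq: "norm (e k x * (- (t\<^sup>2)) ^ k) = e k x * (t\<^sup>2) ^ k" for k x
        using e_nonneg by (simp add: abs_mult power_abs)
      show "AE x in m. summable (\<lambda>k. norm (e k x * (- (t\<^sup>2)) ^ k))"
        unfolding norm_eq using cosh_sums sums_summable by blast
      have "summable (\<lambda>k. (LINT x|m. e k x) * (t\<^sup>2) ^ k)"
      proof (cases "t = 0")
        case True
        then show ?thesis by (simp add: summable_zero_power')
      next
        case False
        then show ?thesis using summable_e[of "\<bar>t\<bar>"] t by simp
      qed
      then show "summable (\<lambda>k. LINT x|m. norm (e k x * (- (t\<^sup>2)) ^ k))"
        unfolding norm_eq by simp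
    qed
    then show ?thesis
      by (simp add: sums_unique[OF cos_sums, symmetric])
  qed
  obtain b where b_nonneg: "\<And>k. 0 \<le> b k" and a_le: "\<And>k. a k \<le> b k"
    and b_sums: "\<And>s. \<bar>s\<bar> < R\<^sup>2 \<Longrightarrow> (\<lambda>k. b k * s ^ k) sums exp (\<Sum>k. a k * s ^ k)"
  proof (rule exp_power_series_dominates[of a "R\<^sup>2"])
    show "a 0 = 0" by (simp add: a_def e_def)
    show "0 \<le> a k" for k
      unfolding a_def by (intro mult_nonneg_nonneg c Bochner_Integration.integral_nonneg e_nonneg)
    show "summable (\<lambda>k. a k * s ^ k)" if s: "0 < s" "s < R\<^sup>2" for s
    proof -
      have "sqrt s < R" using s R real_less_lsqrt by auto
      then have "summable (\<lambda>k. c * ((LINT x|m. e k x) * ((sqrt s)\<^sup>2) ^ k))"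
        using summable_e[of "sqrt s"] s by (intro summable_mult) simp
      then show ?thesis using s by (simp add: a_def mult.assoc)
    qed
    show "0 < R\<^sup>2" using R by simp
  qed blast
  have sq_less: "\<bar>- (t\<^sup>2)\<bar> < R\<^sup>2" if "\<bar>t\<bar> < R" for t
    using that power_strict_mono[of "\<bar>t\<bar>" R 2] by simp
  have "(\<lambda>k. b k * (- (t\<^sup>2)) ^ k) sums expectation (\<lambda>\<omega>. cos (t * Y \<omega>))" if t: "\<bar>t\<bar> < R" for t
  proof -
    have "(\<lambda>k. a k * (- (t\<^sup>2)) ^ k) sums (c * (LINT x|m. cos (t * g x) - 1))"
      unfolding a_def mult.assoc by (intro sums_mult sums_cos t)
    then have "expectation (\<lambda>\<omega>. cos (t * Y \<omega>)) = exp (\<Sum>k. a k * (- (t\<^sup>2)) ^ k)"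
      using char[OF t] by (simp add: sums_iff)
    then show ?thesis using b_sums[OF sq_less[OF t]] by simp
  qed
  from even_moments_of_cos_power_series[OF Y R this]
  have moment: "(\<integral>\<^sup>+\<omega>. ennreal (Y \<omega> ^ (2 * k)) \<partial>M) = ennreal (fact (2 * k) * b k)" for k
    by (subst nn_integral_eq_integral) auto
  {
    fix \<theta> :: real assume \<theta>: "\<bar>\<theta>\<bar> < R"
    have cosh_suminf: "ennreal (cosh (\<theta> * Y \<omega>))
        = (\<Sum>k. ennreal (\<theta> ^ (2 * k) / fact (2 * k)) * ennreal (Y \<omega> ^ (2 * k)))" for \<omega>
    proof -
      have "(\<Sum>k. ennreal (\<theta> ^ (2 * k) / fact (2 * k)) * ennreal (Y \<omega> ^ (2 * k)))
          = (\<Sum>k. ennreal ((\<theta> * Y \<omega>) ^ (2 * k) / fact (2 * k)))"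
        by (simp add: power_mult_distrib flip: ennreal_mult)
      also have "\<dots> = ennreal (\<Sum>k. (\<theta> * Y \<omega>) ^ (2 * k) / fact (2 * k))"
        by (intro suminf_ennreal2 sums_summable[OF cosh_sums_even]) simp
      finally show ?thesis by (simp add: sums_unique[OF cosh_sums_even, symmetric])
    qed
    have "(\<integral>\<^sup>+\<omega>. ennreal (cosh (\<theta> * Y \<omega>)) \<partial>M)
        = (\<Sum>k. \<integral>\<^sup>+\<omega>. ennreal (\<theta> ^ (2 * k) / fact (2 * k)) * ennreal (Y \<omega> ^ (2 * k)) \<partial>M)"
      unfolding cosh_suminf by (rule nn_integral_suminf) measurable
    also have "\<dots> = (\<Sum>k. ennreal (b k * (\<theta>\<^sup>2) ^ k))"
    proof -
      have "(\<integral>\<^sup>+\<omega>. ennreal (\<theta> ^ (2 * k) / fact (2 * k)) * ennreal (Y \<omega> ^ (2 * k)) \<partial>M)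
          = ennreal (\<theta> ^ (2 * k) / fact (2 * k)) * ennreal (fact (2 * k) * b k)" for k
        by (subst nn_integral_cmult) (simp_all add: moment)
      also have "\<dots> k = ennreal (b k * (\<theta>\<^sup>2) ^ k)" for k
        using b_nonneg by (simp add: power_mult flip: ennreal_mult)
      finally show ?thesis by simp
    qed
    also have "\<dots> = ennreal (\<Sum>k. b k * (\<theta>\<^sup>2) ^ k)"
      using b_nonneg sq_less[OF \<theta>]
      by (intro suminf_ennreal2 sums_summable[OF b_sums] mult_nonneg_nonneg) auto
    finally show "(\<integral>\<^sup>+\<omega>. ennreal (cosh (\<theta> * Y \<omega>)) \<partial>M) < \<infinity>" by simp
  next
    fix k :: nat assume k: "k \<ge> 1"
    then have g_pow: "g x ^ (2 * k) = fact (2 * k) * e k x" for x by (simp add: e_def)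
    have "ennreal c * (\<integral>\<^sup>+x. ennreal (g x ^ (2 * k)) \<partial>m) = ennreal (fact (2 * k) * a k)"
      unfolding g_pow a_def using int_e[of k] e_nonneg c
      by (subst nn_integral_eq_integral) (auto simp: mult_ac simp flip: ennreal_mult
          intro!: mult_nonneg_nonneg Bochner_Integration.integral_nonneg)
    also have "\<dots> \<le> ennreal (fact (2 * k) * b k)"
      by (intro ennreal_leI mult_left_mono a_le) simp
    finally show "ennreal c * (\<integral>\<^sup>+x. ennreal (g x ^ (2 * k)) \<partial>m)
        \<le> (\<integral>\<^sup>+\<omega>. ennreal (Y \<omega> ^ (2 * k)) \<partial>M)"
      by (simp only: moment)
  }
qed

section \<open>Characteristic functions of infinitely divisible laws\<close>

lemma norm_iexp_compensated_le:
  "norm (iexp u - 1 - \<i> * complex_of_real u) \<le> u\<^sup>2 / 2"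
  using iexp_approx1[of u 1] by (simp add: algebra_simps power2_eq_square)

text \<open>The compensated integrand is at most a multiple of \<open>\<parallel>x\<parallel>\<^sup>2\<close> in the unit ball and bounded outside.
Integrability matters because the Bochner integral in the exponent would otherwise be \<open>0\<close> by
convention, and its real part could not be taken under the integral sign.\<close>

lemma integrable_levy_exponent:
  fixes \<nu> :: "(real^'n) measure"
  assumes "levy_measure \<nu>"
  shows "complex_integrable \<nu> (\<lambda>x. iexp (inner z x) - 1
           - \<i> * complex_of_real (inner z x * indicator (cball 0 1) x))"
proof -
  have sets_\<nu>: "sets \<nu> = sets (restrict_space borel (- {0}))"
    and fin: "(\<integral>\<^sup>+x. ennreal (min 1 ((norm x)\<^sup>2)) \<partial>\<nu>) < \<infinity>"
    using assms by (auto simp: levy_measure_def)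
  have meas: "h \<in> borel_measurable \<nu>" if "h \<in> borel_measurable borel" for h :: "real^'n \<Rightarrow> 'b::topological_space"
    using measurable_restrict_space1[OF that] measurable_cong_sets[OF sets_\<nu> refl] by blast
  have "integrable \<nu> (\<lambda>x. min 1 ((norm x)\<^sup>2))"
    using fin by (intro integrableI_nonneg meas) auto
  then have "integrable \<nu> (\<lambda>x. ((norm z)\<^sup>2 / 2 + 2) * min 1 ((norm x)\<^sup>2))"
    by simp
  then show ?thesis
  proof (rule Bochner_Integration.integrable_bound)
    have "norm (iexp (inner z x) - 1 - \<i> * complex_of_real (inner z x * indicator (cball 0 1) x))
        \<le> ((norm z)\<^sup>2 / 2 + 2) * min 1 ((norm x)\<^sup>2)" for x
    proof (cases "norm x \<le> 1")
      case True
      then have "norm (iexp (inner z x) - 1 - \<i> * complex_of_real (inner z x * indicator (cball 0 1) x))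
          \<le> (inner z x)\<^sup>2 / 2"
        using norm_iexp_compensated_le by simp
      also have "\<dots> \<le> (norm z * norm x)\<^sup>2 / 2"
        using Cauchy_Schwarz_ineq2[of z x]
        by (intro divide_right_mono iffD1[OF abs_le_square_iff]) (simp_all add: abs_mult)
      also have "\<dots> \<le> ((norm z)\<^sup>2 / 2 + 2) * (norm x)\<^sup>2"
        by (simp add: power_mult_distrib distrib_right)
      also have "(norm x)\<^sup>2 = min 1 ((norm x)\<^sup>2)"
        using power_le_one[OF norm_ge_zero True, of 2] by simp
      finally show ?thesis .
    next
      case False
      then have "norm (iexp (inner z x) - 1 - \<i> * complex_of_real (inner z x * indicator (cball 0 1) x)) \<le> 2"
        using norm_triangle_ineq4[of "iexp (inner z x)" 1] by simp
      also have "\<dots> \<le> ((norm z)\<^sup>2 / 2 + 2) * min 1 ((norm x)\<^sup>2)"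
        using False by (simp add: min_def one_le_power)
      finally show ?thesis .
    qed
    then show "AE x in \<nu>. norm (iexp (inner z x) - 1
          - \<i> * complex_of_real (inner z x * indicator (cball 0 1) x))
        \<le> norm (((norm z)\<^sup>2 / 2 + 2) * min 1 ((norm x)\<^sup>2))"
      by (intro AE_I2) (simp add: abs_mult)
    have [measurable]: "Measurable.pred borel (\<lambda>x::real^'n. x \<in> cball 0 1)"
      unfolding mem_cball by measurable
    show "(\<lambda>x. iexp (inner z x) - 1 - \<i> * complex_of_real (inner z x * indicator (cball 0 1) x))
        \<in> borel_measurable \<nu>"
      by (intro meas) measurable
  qed
qed

text \<open>Taking the modulus removes drift and compensator, which are purely imaginary.\<close>

lemma norm_vec_char_square:
  assumes "has_generating_triplet \<mu> 0 \<nu> b"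
  shows "(norm (vec_char \<mu> z))\<^sup>2 = exp (2 * (LINT x|\<nu>. cos (inner z x) - 1))"
proof -
  let ?h = "\<lambda>x. iexp (inner z x) - 1 - \<i> * complex_of_real (inner z x * indicator (cball 0 1) x)"
  have "complex_integrable \<nu> ?h"
    using assms by (intro integrable_levy_exponent) (simp add: has_generating_triplet_def)
  then have "Re (CLINT x|\<nu>. ?h x) = (LINT x|\<nu>. Re (?h x))"
    by (rule integral_Re[symmetric])
  also have "\<dots> = (LINT x|\<nu>. cos (inner z x) - 1)"
    by (simp add: Re_exp)
  finally have "norm (vec_char \<mu> z) = exp (LINT x|\<nu>. cos (inner z x) - 1)"
    using assms by (simp add: has_generating_triplet_def norm_exp_eq_Re)
  then show ?thesis
    by (simp add: power2_eq_square flip: exp_add)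
qed

text \<open>The sets where \<open>min 1 \<parallel>x\<parallel>\<^sup>2\<close> is at least \<open>1 / n\<close> exhaust the punctured space and have finite measure by
Markov's inequality.\<close>

lemma sigma_finite_levy_measure:
  fixes \<nu> :: "(real^'n) measure"
  assumes "levy_measure \<nu>"
  shows "sigma_finite_measure \<nu>"
proof
  have sets_\<nu>: "sets \<nu> = sets (restrict_space borel (- {0}))"
    and fin: "(\<integral>\<^sup>+x. ennreal (min 1 ((norm x)\<^sup>2)) \<partial>\<nu>) < \<infinity>"
    using assms by (auto simp: levy_measure_def)
  have space_\<nu>: "space \<nu> = - {0}"
    using sets_eq_imp_space_eq[OF sets_\<nu>] by (simp add: space_restrict_space)
  define A where "A n = {x::real^'n. 1 / real (Suc n) \<le> min 1 ((norm x)\<^sup>2)}" for n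
  have A_borel: "A n \<in> sets borel" for n
    unfolding A_def by measurable
  have A_space: "A n \<subseteq> - {0}" for n
    by (auto simp: A_def)
  have A_sets: "A n \<in> sets \<nu>" for n
    using A_borel A_space by (simp add: sets_\<nu> sets_restrict_space_iff)
  have meas: "(\<lambda>x. ennreal (min 1 ((norm x)\<^sup>2))) \<in> borel_measurable \<nu>"
    unfolding measurable_cong_sets[OF sets_\<nu> refl] by (rule measurable_restrict_space1) measurable
  have "emeasure \<nu> (A n) \<noteq> \<infinity>" for n
  proof -
    have "emeasure \<nu> (A n) = (\<integral>\<^sup>+x. indicator (A n) x \<partial>\<nu>)"
      using A_sets by simp
    also have "\<dots> \<le> (\<integral>\<^sup>+x. ennreal (real (Suc n)) * ennreal (min 1 ((norm x)\<^sup>2)) \<partial>\<nu>)"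
    proof (rule nn_integral_mono)
      fix x
      have "1 \<le> real (Suc n) * min 1 ((norm x)\<^sup>2)" if "x \<in> A n"
        using that by (simp add: A_def field_simps)
      then show "indicator (A n) x \<le> ennreal (real (Suc n)) * ennreal (min 1 ((norm x)\<^sup>2))"
        by (auto simp: indicator_def simp flip: ennreal_mult ennreal_1 simp del: of_nat_Suc)
    qed
    also have "\<dots> = ennreal (real (Suc n)) * (\<integral>\<^sup>+x. ennreal (min 1 ((norm x)\<^sup>2)) \<partial>\<nu>)"
      by (rule nn_integral_cmult[OF meas])
    also have "\<dots> < \<infinity>"
      using fin by (simp add: ennreal_mult_less_top)
    finally show ?thesis by simp
  qed
  moreover have "(\<Union>n. A n) = space \<nu>"
  proof
    show "space \<nu> \<subseteq> (\<Union>n. A n)"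
    proof
      fix x assume "x \<in> space \<nu>"
      then have "0 < min 1 ((norm x)\<^sup>2)" by (simp add: space_\<nu>)
      then obtain n where "inverse (real (Suc n)) < min 1 ((norm x)\<^sup>2)"
        using reals_Archimedean by blast
      then have "x \<in> A n" by (simp add: A_def divide_inverse)
      then show "x \<in> (\<Union>n. A n)" by blast
    qed
  qed (use A_space space_\<nu> in auto)
  ultimately show "\<exists>A. countable A \<and> A \<subseteq> sets \<nu> \<and> \<Union> A = space \<nu> \<and> (\<forall>a\<in>A. emeasure \<nu> a \<noteq> \<infinity>)"
    using A_sets by (intro exI[of _ "range A"]) auto
qed

section \<open>Symmetrisation\<close>

lemma (in pair_sigma_finite) integral_prod_mult:
  fixes f :: "'a \<Rightarrow> real" and g :: "'b \<Rightarrow> real"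
  assumes f: "integrable M1 f" and g: "integrable M2 g"
  shows "integrable (M1 \<Otimes>\<^sub>M M2) (\<lambda>\<omega>. f (fst \<omega>) * g (snd \<omega>))"
    and "(LINT \<omega>|(M1 \<Otimes>\<^sub>M M2). f (fst \<omega>) * g (snd \<omega>)) = (LINT x|M1. f x) * (LINT y|M2. g y)"
proof -
  note [measurable] = borel_measurable_integrable[OF f] borel_measurable_integrable[OF g]
  have "integrable (M1 \<Otimes>\<^sub>M M2) (\<lambda>(x, y). f x * g y)"
    using f g by (intro Fubini_integrable) (auto simp: abs_mult)
  then show int: "integrable (M1 \<Otimes>\<^sub>M M2) (\<lambda>\<omega>. f (fst \<omega>) * g (snd \<omega>))"
    by (simp add: split_beta')
  show "(LINT \<omega>|(M1 \<Otimes>\<^sub>M M2). f (fst \<omega>) * g (snd \<omega>)) = (LINT x|M1. f x) * (LINT y|M2. g y)"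
    using integral_fst'[OF int] by simp
qed

text \<open>By the addition theorem the expectation is the sum of the squares of the real and the imaginary
part of the characteristic function.\<close>

lemma (in prob_space) expectation_cos_diff_copies:
  fixes Y :: "'a \<Rightarrow> real"
  assumes [measurable]: "Y \<in> borel_measurable M"
  shows "(LINT \<omega>|(M \<Otimes>\<^sub>M M). cos (Y (fst \<omega>) - Y (snd \<omega>))) = (norm (CLINT x|M. iexp (Y x)))\<^sup>2"
proof -
  have cos: "integrable M (\<lambda>x. cos (Y x))"
    by (rule integrable_const_bound[of _ 1]) auto
  have sin: "integrable M (\<lambda>x. sin (Y x))"
    by (rule integrable_const_bound[of _ 1]) auto
  have "complex_integrable M (\<lambda>x. iexp (Y x))"
    by (rule integrable_const_bound[of _ 1]) auto
  then have char: "Re (CLINT x|M. iexp (Y x)) = expectation (\<lambda>x. cos (Y x))"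
      "Im (CLINT x|M. iexp (Y x)) = expectation (\<lambda>x. sin (Y x))"
    by (simp_all add: Re_exp Im_exp flip: integral_Re integral_Im)
  interpret pair_prob_space M M ..
  show ?thesis
    unfolding cmod_power2 cos_diff char
    by (simp add: integral_prod_mult[OF cos cos] integral_prod_mult[OF sin sin] power2_eq_square)
qed

lemma nn_integral_pair_mult:
  fixes f :: "'a \<Rightarrow> ennreal" and g :: "'b \<Rightarrow> ennreal"
  assumes "sigma_finite_measure N" and [measurable]: "f \<in> borel_measurable M" "g \<in> borel_measurable N"
  shows "(\<integral>\<^sup>+\<omega>. f (fst \<omega>) * g (snd \<omega>) \<partial>(M \<Otimes>\<^sub>M N)) = (\<integral>\<^sup>+x. f x \<partial>M) * (\<integral>\<^sup>+y. g y \<partial>N)"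
proof -
  interpret sigma_finite_measure N by fact
  have "(\<integral>\<^sup>+\<omega>. f (fst \<omega>) * g (snd \<omega>) \<partial>(M \<Otimes>\<^sub>M N)) = (\<integral>\<^sup>+x. \<integral>\<^sup>+y. f x * g y \<partial>N \<partial>M)"
    by (subst nn_integral_fst[symmetric]) simp_all
  also have "\<dots> = (\<integral>\<^sup>+x. f x * (\<integral>\<^sup>+y. g y \<partial>N) \<partial>M)"
    by (simp add: nn_integral_cmult)
  finally show ?thesis by (simp add: nn_integral_multc)
qed

section \<open>The standard Gaussian law as a substitute for the uniform law on the sphere\<close>

text \<open>What is needed of a rotation invariant law is that the even moments of \<open>\<langle>z, x\<rangle>\<close> depend on \<open>x\<close>
through its norm only.  For the Gaussian law this is read off from the characteristic function, so
that no change of variables by orthogonal maps is required.\<close>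

definition std_gaussian :: "(real^'n) measure" where
  "std_gaussian = distr (Pi\<^sub>M UNIV (\<lambda>_. std_normal_distribution)) borel (\<lambda>\<omega>. \<chi> i. \<omega> i)"

lemma sets_std_gaussian [simp, measurable_cong]: "sets std_gaussian = sets borel"
  by (simp add: std_gaussian_def)

lemma measurable_vec_lambda_PiM [measurable]:
  "(\<lambda>\<omega>. \<chi> i. \<omega> i) \<in> (Pi\<^sub>M UNIV (\<lambda>_::'n::finite. std_normal_distribution)) \<rightarrow>\<^sub>M (borel :: (real^'n) measure)"
proof (subst borel_measurable_euclidean_space, rule ballI)
  fix u :: "real^'n" assume "u \<in> Basis"
  have "(\<lambda>\<omega>. (\<Sum>i\<in>UNIV. \<omega> i * u $ i)) \<in> borel_measurable (Pi\<^sub>M UNIV (\<lambda>_::'n. std_normal_distribution))"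
    by measurable
  then show "(\<lambda>\<omega>. inner (\<chi> i. \<omega> i) u) \<in> borel_measurable (Pi\<^sub>M UNIV (\<lambda>_::'n. std_normal_distribution))"
    by (simp add: inner_vec_def)
qed

lemma prob_space_std_gaussian: "prob_space (std_gaussian :: (real^'n) measure)"
proof -
  interpret product_prob_space "\<lambda>_. std_normal_distribution" "UNIV :: 'n set"
    by (rule product_prob_spaceI) (simp add: prob_space_normal_density)
  show ?thesis
    unfolding std_gaussian_def by (rule prob_space_distr) measurable
qed

lemma vec_char_std_gaussian:
  "vec_char (std_gaussian :: (real^'n) measure) u = of_real (exp (- (norm u)\<^sup>2 / 2))"
proof -
  interpret product_prob_space "\<lambda>_. std_normal_distribution" "UNIV :: 'n set"
    by (rule product_prob_spaceI) (simp add: prob_space_normal_density)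
  have "vec_char std_gaussian u
      = (CLINT \<omega>|Pi\<^sub>M UNIV (\<lambda>_::'n. std_normal_distribution). (\<Prod>i\<in>UNIV. iexp (u $ i * \<omega> i)))"
  proof -
    have "iexp (inner u (\<chi> i. \<omega> i)) = (\<Prod>i\<in>UNIV. iexp (u $ i * \<omega> i))" for \<omega> :: "'n \<Rightarrow> real"
      by (simp only: inner_vec_def inner_real_def vec_lambda_beta of_real_sum sum_distrib_left
          exp_sum[OF finite])
    then show ?thesis
      unfolding vec_char_def std_gaussian_def by (subst integral_distr) simp_all
  qed
  also have "\<dots> = (\<Prod>i\<in>UNIV. CLINT x|std_normal_distribution. iexp (u $ i * x))"
  proof (rule product_integral_prod)
    fix i
    show "complex_integrable std_normal_distribution (\<lambda>x. iexp (u $ i * x))"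
      by (rule M.integrable_const_bound[where B = 1]) auto
  qed simp
  also have "\<dots> = (\<Prod>i\<in>UNIV. complex_of_real (exp (- ((u $ i)\<^sup>2) / 2)))"
    using fun_cong[OF char_std_normal_distribution] by (simp only: char_def)
  also have "\<dots> = of_real (exp (\<Sum>i\<in>UNIV. - ((u $ i)\<^sup>2) / 2))"
    by (simp only: of_real_prod[symmetric] exp_sum[OF finite])
  also have "(\<Sum>i\<in>UNIV. - ((u $ i)\<^sup>2) / 2) = - (norm u)\<^sup>2 / 2"
  proof -
    have "(norm u)\<^sup>2 = (\<Sum>i\<in>UNIV. (u $ i)\<^sup>2)"
      unfolding power2_norm_eq_inner by (simp add: inner_vec_def power2_eq_square)
    then show ?thesis by (simp add: sum_negf sum_divide_distrib)
  qed
  finally show ?thesis .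
qed

text \<open>The characteristic function of \<open>\<langle>z, x\<rangle>\<close> is \<open>exp (- t\<^sup>2 \<parallel>x\<parallel>\<^sup>2 / 2)\<close>, a power series in \<open>- t\<^sup>2\<close>.\<close>

lemma even_moments_std_gaussian:
  fixes x :: "real^'n"
  shows "(\<integral>\<^sup>+z. ennreal (inner z x ^ (2 * k)) \<partial>std_gaussian)
    = ennreal (fact (2 * k) / (2 ^ k * fact k)) * ennreal (norm x ^ (2 * k))"
proof -
  interpret prob_space "std_gaussian :: (real^'n) measure" by (rule prob_space_std_gaussian)
  let ?b = "\<lambda>k. ((norm x)\<^sup>2 / 2) ^ k / fact k"
  have meas: "(\<lambda>z. inner z x) \<in> borel_measurable (std_gaussian :: (real^'n) measure)"
    by measurable
  have sums: "(\<lambda>k. ?b k * (- (t\<^sup>2)) ^ k) sums expectation (\<lambda>z. cos (t * inner z x))" for t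
  proof -
    have "complex_integrable std_gaussian (\<lambda>z. iexp (inner (t *\<^sub>R x) z))"
      by (rule integrable_const_bound[of _ 1]) auto
    then have "expectation (\<lambda>z. cos (t * inner z x)) = Re (vec_char std_gaussian (t *\<^sub>R x))"
      unfolding vec_char_def by (subst integral_Re[symmetric]) (simp_all add: Re_exp inner_commute)
    also have "\<dots> = exp ((norm x)\<^sup>2 / 2 * (- (t\<^sup>2)))"
      by (simp add: vec_char_std_gaussian power_mult_distrib mult_ac)
    finally have "expectation (\<lambda>z. cos (t * inner z x)) = exp ((norm x)\<^sup>2 / 2 * (- (t\<^sup>2)))" .
    moreover have "(\<lambda>k. ((norm x)\<^sup>2 / 2 * (- (t\<^sup>2))) ^ k /\<^sub>R fact k) sums exp ((norm x)\<^sup>2 / 2 * (- (t\<^sup>2)))"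
      by (rule exp_converges)
    moreover have "((norm x)\<^sup>2 / 2 * (- (t\<^sup>2))) ^ k /\<^sub>R fact k = ?b k * (- (t\<^sup>2)) ^ k" for k
      by (simp only: power_mult_distrib real_scaleR_def divide_inverse mult_ac)
    ultimately show ?thesis by (simp only:)
  qed
  have "(\<integral>\<^sup>+z. ennreal (inner z x ^ (2 * k)) \<partial>std_gaussian) = ennreal (fact (2 * k) * ?b k)"
    using even_moments_of_cos_power_series[OF meas zero_less_one sums]
    by (subst nn_integral_eq_integral) auto
  also have "\<dots> = ennreal (fact (2 * k) / (2 ^ k * fact k)) * ennreal (norm x ^ (2 * k))"
    by (simp add: power_divide power_mult flip: ennreal_mult)
  finally show ?thesis .
qed

section \<open>Exponential moments and the Levy measure\<close>

text \<open>Since \<open>cosh u - 1\<close> is of order \<open>u\<^sup>2\<close> at \<open>0\<close>, the condition on \<open>cosh\<close> restricts only the large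
jumps: it says that \<open>\<nu>\<close> has exponential moments of every order below \<open>R\<close> away from the origin.\<close>

locale infinitely_divisible_exp_jumps =
  fixes \<mu> \<nu> :: "(real^'n) measure" and b :: "real^'n" and R :: real
  assumes prob: "prob_space \<mu>" and sets_\<mu> [measurable_cong]: "sets \<mu> = sets borel"
    and triplet: "has_generating_triplet \<mu> 0 \<nu> b"
    and R_pos: "0 < R"
    and cosh_finite: "\<And>\<theta>. 0 < \<theta> \<Longrightarrow> \<theta> < R \<Longrightarrow> (\<integral>\<^sup>+x. ennreal (cosh (\<theta> * norm x) - 1) \<partial>\<nu>) < \<infinity>"
begin

sublocale prob_space \<mu> by (rule prob)

sublocale pair: pair_prob_space \<mu> \<mu> ..

lemma borel_measurable_levy:
  fixes h :: "real^'n \<Rightarrow> 'b::topological_space"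
  assumes "h \<in> borel_measurable borel"
  shows "h \<in> borel_measurable \<nu>"
  using measurable_restrict_space1[OF assms] triplet measurable_cong_sets[of \<nu> "restrict_space borel (- {0})"]
  unfolding has_generating_triplet_def levy_measure_def by blast

text \<open>The radius \<open>r\<close> is shorter than \<open>R\<close> when \<open>z\<close> is long, because \<open>\<bar>\<langle>z, x\<rangle>\<bar> \<le> \<parallel>z\<parallel> \<parallel>x\<parallel>\<close>; the
inequality between moments is then available for every \<open>z\<close>.\<close>

lemma symmetrised_projection:
  fixes z :: "real^'n"
  assumes r: "0 < r" "r * norm z \<le> R"
  shows cosh_projection_finite: "\<And>\<theta>. \<bar>\<theta>\<bar> < r \<Longrightarrow>
      (\<integral>\<^sup>+\<omega>. ennreal (cosh (\<theta> * inner z (fst \<omega> - snd \<omega>))) \<partial>(\<mu> \<Otimes>\<^sub>M \<mu>)) < \<infinity>"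
    and moment_projection_ge: "\<And>k. k \<ge> 1 \<Longrightarrow> 2 * (\<integral>\<^sup>+x. ennreal (inner z x ^ (2 * k)) \<partial>\<nu>)
      \<le> (\<integral>\<^sup>+\<omega>. ennreal (inner z (fst \<omega> - snd \<omega>) ^ (2 * k)) \<partial>(\<mu> \<Otimes>\<^sub>M \<mu>))"
proof -
  have "(\<lambda>\<omega>. inner z (fst \<omega> - snd \<omega>)) \<in> borel_measurable (\<mu> \<Otimes>\<^sub>M \<mu>)"
    by measurable
  moreover have "inner z \<in> borel_measurable \<nu>"
    by (intro borel_measurable_levy) measurable
  moreover have "(\<integral>\<^sup>+x. ennreal (cosh (\<theta> * inner z x) - 1) \<partial>\<nu>) < \<infinity>" if \<theta>: "0 < \<theta>" "\<theta> < r" for \<theta>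
  proof -
    \<comment> \<open>This exponent dominates \<open>\<theta> \<parallel>z\<parallel>\<close> and is still below \<open>R\<close>.\<close>
    let ?\<theta>' = "\<theta> * R / r"
    have "\<theta> * norm z \<le> ?\<theta>'"
      using r \<theta> by (simp add: field_simps)
    then have "\<bar>\<theta> * inner z x\<bar> \<le> ?\<theta>' * norm x" for x
    proof -
      have "\<bar>\<theta> * inner z x\<bar> \<le> \<theta> * (norm z * norm x)"
        using \<theta> Cauchy_Schwarz_ineq2[of z x] by (simp add: abs_mult)
      also have "\<dots> \<le> ?\<theta>' * norm x"
        using mult_right_mono[OF \<open>\<theta> * norm z \<le> ?\<theta>'\<close>, of "norm x"] by (simp add: mult.assoc)
      finally show ?thesis .
    qed
    then have "(\<integral>\<^sup>+x. ennreal (cosh (\<theta> * inner z x) - 1) \<partial>\<nu>)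
        \<le> (\<integral>\<^sup>+x. ennreal (cosh (?\<theta>' * norm x) - 1) \<partial>\<nu>)"
      by (intro nn_integral_mono ennreal_leI diff_right_mono cosh_le_cosh_of_abs_le)
    also have "\<dots> < \<infinity>"
      using r \<theta> R_pos by (intro cosh_finite) (auto simp: field_simps)
    finally show ?thesis .
  qed
  moreover have "(LINT \<omega>|(\<mu> \<Otimes>\<^sub>M \<mu>). cos (t * inner z (fst \<omega> - snd \<omega>)))
      = exp (2 * (LINT x|\<nu>. cos (t * inner z x) - 1))" for t
    using expectation_cos_diff_copies[of "\<lambda>x. inner (t *\<^sub>R z) x"] norm_vec_char_square[OF triplet, of "t *\<^sub>R z"]
    by (simp add: vec_char_def inner_diff_right right_diff_distrib)
  ultimately show "\<And>\<theta>. \<bar>\<theta>\<bar> < r \<Longrightarrow>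
      (\<integral>\<^sup>+\<omega>. ennreal (cosh (\<theta> * inner z (fst \<omega> - snd \<omega>))) \<partial>(\<mu> \<Otimes>\<^sub>M \<mu>)) < \<infinity>"
    and "\<And>k. k \<ge> 1 \<Longrightarrow> 2 * (\<integral>\<^sup>+x. ennreal (inner z x ^ (2 * k)) \<partial>\<nu>)
      \<le> (\<integral>\<^sup>+\<omega>. ennreal (inner z (fst \<omega> - snd \<omega>) ^ (2 * k)) \<partial>(\<mu> \<Otimes>\<^sub>M \<mu>))"
    using pair.nn_integral_cosh_finite[where m = \<nu> and c = 2 and R = r and g = "inner z"
        and Y = "\<lambda>\<omega>. inner z (fst \<omega> - snd \<omega>)"]
      pair.even_moment_ge[where m = \<nu> and c = 2 and R = r and g = "inner z"
        and Y = "\<lambda>\<omega>. inner z (fst \<omega> - snd \<omega>)"] r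
    by simp_all
qed

text \<open>Desymmetrisation: by independence \<open>E exp (\<theta> \<langle>z, X - X'\<rangle>)\<close> is the product of \<open>E exp (\<theta> \<langle>z, X\<rangle>)\<close>
and a strictly positive factor.\<close>

lemma exp_projection_finite:
  fixes z :: "real^'n"
  assumes z: "norm z = 1" and \<theta>: "0 < \<theta>" "\<theta> < R"
  shows "(\<integral>\<^sup>+x. ennreal (exp (\<theta> * inner z x)) \<partial>\<mu>) < \<infinity>"
proof -
  let ?A = "\<integral>\<^sup>+x. ennreal (exp (\<theta> * inner z x)) \<partial>\<mu>"
  let ?B = "\<integral>\<^sup>+x. ennreal (exp (- (\<theta> * inner z x))) \<partial>\<mu>"
  have "?A * ?B = (\<integral>\<^sup>+\<omega>. ennreal (exp (\<theta> * inner z (fst \<omega> - snd \<omega>))) \<partial>(\<mu> \<Otimes>\<^sub>M \<mu>))"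
    by (subst nn_integral_pair_mult[symmetric])
       (auto simp: inner_diff_right right_diff_distrib exp_diff exp_minus divide_inverse
         simp flip: ennreal_mult intro: prob_space_imp_sigma_finite prob)
  also have "\<dots> \<le> (\<integral>\<^sup>+\<omega>. 2 * ennreal (cosh (\<theta> * inner z (fst \<omega> - snd \<omega>))) \<partial>(\<mu> \<Otimes>\<^sub>M \<mu>))"
    using exp_le_two_cosh by (intro nn_integral_mono) (simp add: ennreal_mult'[symmetric] flip: ennreal_numeral)
  also have "\<dots> = 2 * (\<integral>\<^sup>+\<omega>. ennreal (cosh (\<theta> * inner z (fst \<omega> - snd \<omega>))) \<partial>(\<mu> \<Otimes>\<^sub>M \<mu>))"
    by (rule nn_integral_cmult) measurable
  also have "\<dots> < \<infinity>"
    using cosh_projection_finite[of R z \<theta>] z \<theta> by (simp add: ennreal_mult_less_top)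
  finally have "?A * ?B < \<infinity>" .
  moreover have "?B \<noteq> 0"
    by (subst nn_integral_0_iff_AE) (auto simp: AE_False emeasure_space_1)
  ultimately show ?thesis
    by (auto simp: ennreal_mult_less_top less_top[symmetric] ennreal_mult_eq_top_iff)
qed

text \<open>If \<open>Z\<close> is an \<open>\<epsilon>\<close>-net of the sphere, then \<open>(1 - \<epsilon>) \<parallel>x\<parallel> \<le> \<langle>z, x\<rangle>\<close> for some \<open>z \<in> Z\<close>.  As \<open>\<zeta> < R\<close> is a
strict inequality, there is room for the factor \<open>1 - \<epsilon>\<close>.\<close>

lemma exp_norm_finite:
  assumes \<zeta>: "\<zeta> < R"
  shows "(\<integral>\<^sup>+x. ennreal (exp (\<zeta> * norm x)) \<partial>\<mu>) < \<infinity>"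
proof (cases "\<zeta> \<le> 0")
  case True
  then have "(\<integral>\<^sup>+x. ennreal (exp (\<zeta> * norm x)) \<partial>\<mu>) \<le> (\<integral>\<^sup>+x. 1 \<partial>\<mu>)"
    by (intro nn_integral_mono) (simp add: mult_nonpos_nonneg)
  also have "\<dots> < \<infinity>" by (simp add: emeasure_space_1)
  finally show ?thesis .
next
  case False
  define \<theta> where "\<theta> = (\<zeta> + R) / 2"
  have \<theta>: "0 < \<theta>" "\<zeta> < \<theta>" "\<theta> < R" using False \<zeta> by (auto simp: \<theta>_def)
  define \<epsilon> where "\<epsilon> = 1 - \<zeta> / \<theta>"
  have \<epsilon>: "0 < \<epsilon>" "\<theta> * (1 - \<epsilon>) = \<zeta>" using \<theta> by (auto simp: \<epsilon>_def field_simps)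
  obtain Z :: "(real^'n) set" where Z: "Z \<subseteq> sphere 0 1" "finite Z" "sphere 0 1 \<subseteq> (\<Union>z\<in>Z. ball z \<epsilon>)"
    by (rule compactE_image[of "sphere 0 1" "sphere 0 1 :: (real^'n) set" "\<lambda>z. ball z \<epsilon>"])
       (use \<epsilon> in \<open>auto intro: bexI centre_in_ball[THEN iffD2]\<close>)
  have bound: "exp (\<zeta> * norm x) \<le> 1 + (\<Sum>z\<in>Z. exp (\<theta> * inner z x))" for x
  proof (cases "x = 0")
    case True
    then show ?thesis by (simp add: sum_nonneg)
  next
    case False
    define u where "u = x /\<^sub>R norm x"
    have u: "u \<in> sphere 0 1" "x = norm x *\<^sub>R u" using False by (auto simp: u_def)
    from u(1) Z(3) have "u \<in> (\<Union>z\<in>Z. ball z \<epsilon>)" by blast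
    then obtain z where z: "z \<in> Z" "dist z u < \<epsilon>" by auto
    have "inner u u = 1" using u by (simp add: dot_square_norm)
    then have "inner z u = 1 - inner (u - z) u" by (simp add: inner_diff_left)
    moreover have "inner (u - z) u \<le> norm (u - z) * norm u" by (rule norm_cauchy_schwarz)
    ultimately have "1 - \<epsilon> \<le> inner z u" using z u by (simp add: dist_norm norm_minus_commute)
    then have "\<theta> * (1 - \<epsilon>) * norm x \<le> \<theta> * inner z u * norm x"
      using \<theta> by (intro mult_right_mono mult_left_mono) auto
    also have "\<theta> * inner z u * norm x = \<theta> * inner z x"
    proof -
      have "inner z x = norm x * inner z u" by (metis u(2) inner_scaleR_right)
      then show ?thesis by simp
    qed
    finally have "exp (\<zeta> * norm x) \<le> exp (\<theta> * inner z x)" using \<epsilon> by simp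
    also have "\<dots> \<le> (\<Sum>z\<in>Z. exp (\<theta> * inner z x))"
      using z Z by (intro member_le_sum) auto
    finally show ?thesis by simp
  qed
  have "(\<integral>\<^sup>+x. ennreal (exp (\<zeta> * norm x)) \<partial>\<mu>)
      \<le> (\<integral>\<^sup>+x. 1 + (\<Sum>z\<in>Z. ennreal (exp (\<theta> * inner z x))) \<partial>\<mu>)"
    using bound by (intro nn_integral_mono) (simp add: sum_nonneg flip: ennreal_plus ennreal_1)
  also have "\<dots> = 1 + (\<Sum>z\<in>Z. \<integral>\<^sup>+x. ennreal (exp (\<theta> * inner z x)) \<partial>\<mu>)"
    by (simp add: nn_integral_add nn_integral_sum emeasure_space_1 del: sum_ennreal)
  also have "\<dots> < \<infinity>"
    using exp_projection_finite[of _ \<theta>] \<theta> Z by (auto simp: subset_eq)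
  finally show ?thesis .
qed

text \<open>The inequality for projections, averaged over a Gaussian \<open>z\<close>.  By Tonelli both averages are the
same multiple \<open>?C\<close> of the even moments of the norm.\<close>

lemma norm_moment_ge:
  assumes k: "k \<ge> 1"
  shows "2 * (\<integral>\<^sup>+x. ennreal (norm x ^ (2 * k)) \<partial>\<nu>)
    \<le> (\<integral>\<^sup>+\<omega>. ennreal (norm (fst \<omega> - snd \<omega>) ^ (2 * k)) \<partial>(\<mu> \<Otimes>\<^sub>M \<mu>))"
proof -
  let ?G = "std_gaussian :: (real^'n) measure"
  let ?C = "ennreal (fact (2 * k) / (2 ^ k * fact k))"
  interpret G: prob_space ?G by (rule prob_space_std_gaussian)
  interpret \<nu>: sigma_finite_measure \<nu>
    using triplet by (intro sigma_finite_levy_measure) (simp add: has_generating_triplet_def)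
  interpret G\<nu>: pair_sigma_finite ?G \<nu> ..
  interpret GP: pair_sigma_finite ?G "\<mu> \<Otimes>\<^sub>M \<mu>" ..
  have [measurable]: "(\<lambda>x. x) \<in> \<nu> \<rightarrow>\<^sub>M borel"
    by (intro borel_measurable_levy) measurable
  have "?C * (2 * (\<integral>\<^sup>+x. ennreal (norm x ^ (2 * k)) \<partial>\<nu>))
      = 2 * (\<integral>\<^sup>+x. (\<integral>\<^sup>+z. ennreal (inner z x ^ (2 * k)) \<partial>?G) \<partial>\<nu>)"
  proof -
    have "(\<integral>\<^sup>+x. (\<integral>\<^sup>+z. ennreal (inner z x ^ (2 * k)) \<partial>?G) \<partial>\<nu>)
        = ?C * (\<integral>\<^sup>+x. ennreal (norm x ^ (2 * k)) \<partial>\<nu>)"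
      unfolding even_moments_std_gaussian by (rule nn_integral_cmult) measurable
    then show ?thesis by (simp only: mult.left_commute)
  qed
  also have "\<dots> = (\<integral>\<^sup>+z. 2 * (\<integral>\<^sup>+x. ennreal (inner z x ^ (2 * k)) \<partial>\<nu>) \<partial>?G)"
  proof -
    have "(\<integral>\<^sup>+x. (\<integral>\<^sup>+z. ennreal (inner z x ^ (2 * k)) \<partial>?G) \<partial>\<nu>)
        = (\<integral>\<^sup>+z. (\<integral>\<^sup>+x. ennreal (inner z x ^ (2 * k)) \<partial>\<nu>) \<partial>?G)"
      by (rule G\<nu>.Fubini') measurable
    moreover have "(\<integral>\<^sup>+z. 2 * (\<integral>\<^sup>+x. ennreal (inner z x ^ (2 * k)) \<partial>\<nu>) \<partial>?G)
        = 2 * (\<integral>\<^sup>+z. (\<integral>\<^sup>+x. ennreal (inner z x ^ (2 * k)) \<partial>\<nu>) \<partial>?G)"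
      by (rule nn_integral_cmult) measurable
    ultimately show ?thesis by (simp only:)
  qed
  also have "\<dots> \<le> (\<integral>\<^sup>+z. (\<integral>\<^sup>+\<omega>. ennreal (inner z (fst \<omega> - snd \<omega>) ^ (2 * k)) \<partial>(\<mu> \<Otimes>\<^sub>M \<mu>)) \<partial>?G)"
  proof (rule nn_integral_mono)
    fix z :: "real^'n"
    have "norm z \<le> 1 + norm z" by simp
    then show "2 * (\<integral>\<^sup>+x. ennreal (inner z x ^ (2 * k)) \<partial>\<nu>)
        \<le> (\<integral>\<^sup>+\<omega>. ennreal (inner z (fst \<omega> - snd \<omega>) ^ (2 * k)) \<partial>(\<mu> \<Otimes>\<^sub>M \<mu>))"
      using R_pos by (intro moment_projection_ge[of "R / (1 + norm z)"] k) (simp_all add: field_simps add_pos_nonneg)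
  qed
  also have "\<dots> = (\<integral>\<^sup>+\<omega>. (\<integral>\<^sup>+z. ennreal (inner z (fst \<omega> - snd \<omega>) ^ (2 * k)) \<partial>?G) \<partial>(\<mu> \<Otimes>\<^sub>M \<mu>))"
    by (rule GP.Fubini'[symmetric]) measurable
  also have "\<dots> = ?C * (\<integral>\<^sup>+\<omega>. ennreal (norm (fst \<omega> - snd \<omega>) ^ (2 * k)) \<partial>(\<mu> \<Otimes>\<^sub>M \<mu>))"
    unfolding even_moments_std_gaussian by (rule nn_integral_cmult) measurable
  finally show ?thesis
    by (subst (asm) ennreal_mult_le_mult_iff) auto
qed

text \<open>Sum of the inequalities between even moments with the weights \<open>c\<^sup>2\<^sup>k / (2k)!\<close>, \<open>k \<ge> 1\<close>, followed by
\<open>\<parallel>X - X'\<parallel> \<le> \<parallel>X\<parallel> + \<parallel>X'\<parallel>\<close> and independence.  The case \<open>c = R\<close>, for which nothing is known about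
the finiteness of the left-hand side, is the one of interest.\<close>

lemma cosh_levy_integral_le:
  assumes c: "0 \<le> c"
  shows "2 * (\<integral>\<^sup>+x. ennreal (cosh (c * norm x) - 1) \<partial>\<nu>)
    \<le> (\<integral>\<^sup>+x. ennreal (exp (c * norm x)) \<partial>\<mu>)\<^sup>2"
proof -
  have meas_exp: "(\<lambda>x. ennreal (exp (c * norm x))) \<in> borel_measurable \<mu>"
    by measurable
  have [measurable]: "(\<lambda>x. x) \<in> \<nu> \<rightarrow>\<^sub>M borel"
    by (intro borel_measurable_levy) measurable
  let ?w = "\<lambda>k. ennreal (c ^ (2 * Suc k) / fact (2 * Suc k))"
  have expand: "ennreal (cosh (c * y) - 1) = (\<Sum>k. ?w k * ennreal (y ^ (2 * Suc k)))" for y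
  proof -
    have "(\<lambda>k. (c * y) ^ (2 * Suc k) / fact (2 * Suc k)) sums (cosh (c * y) - 1)"
      using cosh_sums_even[of "c * y"]
        sums_Suc_iff[of "\<lambda>k. (c * y) ^ (2 * k) / fact (2 * k)" "cosh (c * y) - 1"] by simp
    moreover have "0 \<le> (c * y) ^ (2 * Suc k) / fact (2 * Suc k)" for k
      by (intro divide_nonneg_nonneg zero_le_even_power) auto
    ultimately have "ennreal (cosh (c * y) - 1) = (\<Sum>k. ennreal ((c * y) ^ (2 * Suc k) / fact (2 * Suc k)))"
      by (subst suminf_ennreal2) (auto simp only: sums_iff)
    also have "\<dots> = (\<Sum>k. ?w k * ennreal (y ^ (2 * Suc k)))"
      using c by (intro suminf_cong)
        (simp only: power_mult_distrib times_divide_eq_left[symmetric] ennreal_mult' zero_le_power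
          divide_nonneg_nonneg fact_ge_zero)
    finally show ?thesis .
  qed
  have "2 * (\<integral>\<^sup>+x. ennreal (cosh (c * norm x) - 1) \<partial>\<nu>)
      = (\<Sum>k. ?w k * (2 * (\<integral>\<^sup>+x. ennreal (norm x ^ (2 * Suc k)) \<partial>\<nu>)))"
  proof -
    have "(\<integral>\<^sup>+x. ennreal (cosh (c * norm x) - 1) \<partial>\<nu>)
        = (\<Sum>k. \<integral>\<^sup>+x. ?w k * ennreal (norm x ^ (2 * Suc k)) \<partial>\<nu>)"
      unfolding expand by (rule nn_integral_suminf) measurable
    also have "\<dots> = (\<Sum>k. ?w k * (\<integral>\<^sup>+x. ennreal (norm x ^ (2 * Suc k)) \<partial>\<nu>))"
      by (intro suminf_cong nn_integral_cmult) measurable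
    also have "2 * \<dots> = (\<Sum>k. 2 * (?w k * (\<integral>\<^sup>+x. ennreal (norm x ^ (2 * Suc k)) \<partial>\<nu>)))"
      by (rule ennreal_suminf_cmult[symmetric])
    finally show ?thesis by (simp only: mult.left_commute)
  qed
  also have "\<dots> \<le> (\<Sum>k. ?w k * (\<integral>\<^sup>+\<omega>. ennreal (norm (fst \<omega> - snd \<omega>) ^ (2 * Suc k)) \<partial>(\<mu> \<Otimes>\<^sub>M \<mu>)))"
    by (intro suminf_le mult_left_mono norm_moment_ge) auto
  also have "\<dots> = (\<integral>\<^sup>+\<omega>. ennreal (cosh (c * norm (fst \<omega> - snd \<omega>)) - 1) \<partial>(\<mu> \<Otimes>\<^sub>M \<mu>))"
  proof -
    have "(\<integral>\<^sup>+\<omega>. ennreal (cosh (c * norm (fst \<omega> - snd \<omega>)) - 1) \<partial>(\<mu> \<Otimes>\<^sub>M \<mu>))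
        = (\<Sum>k. \<integral>\<^sup>+\<omega>. ?w k * ennreal (norm (fst \<omega> - snd \<omega>) ^ (2 * Suc k)) \<partial>(\<mu> \<Otimes>\<^sub>M \<mu>))"
      unfolding expand by (rule nn_integral_suminf) measurable
    also have "\<dots> = (\<Sum>k. ?w k * (\<integral>\<^sup>+\<omega>. ennreal (norm (fst \<omega> - snd \<omega>) ^ (2 * Suc k)) \<partial>(\<mu> \<Otimes>\<^sub>M \<mu>)))"
      by (intro suminf_cong nn_integral_cmult) measurable
    finally show ?thesis by simp
  qed
  also have "\<dots> \<le> (\<integral>\<^sup>+\<omega>. ennreal (exp (c * norm (fst \<omega>))) * ennreal (exp (c * norm (snd \<omega>))) \<partial>(\<mu> \<Otimes>\<^sub>M \<mu>))"
  proof (rule nn_integral_mono)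
    fix \<omega> :: "(real^'n) \<times> (real^'n)"
    have "cosh (c * norm (fst \<omega> - snd \<omega>)) - 1 \<le> exp (c * norm (fst \<omega> - snd \<omega>))"
      using cosh_le_exp[OF mult_nonneg_nonneg[OF c norm_ge_zero]]
      by (rule order_trans[rotated]) simp
    also have "\<dots> \<le> exp (c * (norm (fst \<omega>) + norm (snd \<omega>)))"
      using c norm_triangle_ineq4[of "fst \<omega>" "snd \<omega>"] by (simp add: mult_left_mono)
    finally show "ennreal (cosh (c * norm (fst \<omega> - snd \<omega>)) - 1)
        \<le> ennreal (exp (c * norm (fst \<omega>))) * ennreal (exp (c * norm (snd \<omega>)))"
      by (simp add: distrib_left exp_add ennreal_leI flip: ennreal_mult)
  qed
  also have "\<dots> = (\<integral>\<^sup>+x. ennreal (exp (c * norm x)) \<partial>\<mu>)\<^sup>2"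
    unfolding power2_eq_square
    by (rule nn_integral_pair_mult[OF prob_space_imp_sigma_finite[OF prob] meas_exp meas_exp])
  finally show ?thesis .
qed

end

section \<open>The Levy measure of a Lamperti stable law\<close>

lemma lamperti_parameters_measurable:
  assumes "lamperti_parameters \<alpha> f \<sigma>"
  shows "f \<in> borel_measurable \<sigma>" "(\<lambda>x. x) \<in> \<sigma> \<rightarrow>\<^sub>M (borel :: (real^'n) measure)"
    "space \<sigma> = sphere 0 1"
proof -
  have sets_\<sigma>: "sets \<sigma> = sets (restrict_space borel (sphere 0 1))"
    and f: "f \<in> borel_measurable (restrict_space borel (sphere 0 1))"
    using assms by (auto simp: lamperti_parameters_def)
  show "f \<in> borel_measurable \<sigma>"
    using f measurable_cong_sets[OF sets_\<sigma> refl] by blast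
  show "(\<lambda>x. x) \<in> \<sigma> \<rightarrow>\<^sub>M (borel :: (real^'n) measure)"
    unfolding measurable_cong_sets[OF sets_\<sigma> refl] by (rule measurable_restrict_space1) measurable
  show "space \<sigma> = sphere 0 1"
    using sets_eq_imp_space_eq[OF sets_\<sigma>] by (simp add: space_restrict_space)
qed

lemma nn_integral_lamperti_levy:
  fixes \<sigma> :: "(real^'n) measure" and h :: "real^'n \<Rightarrow> ennreal"
  assumes params: "lamperti_parameters \<alpha> f \<sigma>" and h: "h \<in> borel_measurable borel"
  shows "(\<integral>\<^sup>+x. h x \<partial>lamperti_levy \<alpha> f \<sigma>) =
     (\<integral>\<^sup>+\<xi>. (\<integral>\<^sup>+r\<in>{0<..}.
        h (r *\<^sub>R \<xi>) * ennreal (exp (r * f \<xi>) * (exp r - 1) powr (- (\<alpha> + 1))) \<partial>lborel) \<partial>\<sigma>)"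
  using h
proof (induction h rule: borel_measurable_induct)
  note [measurable] = lamperti_parameters_measurable(1,2)[OF params]
  have levy_meas: "h \<in> borel_measurable (lamperti_levy \<alpha> f \<sigma>)"
    if "h \<in> borel_measurable borel" for h :: "real^'n \<Rightarrow> ennreal"
    using measurable_restrict_space1[OF that] measurable_cong_sets[OF sets_lamperti_levy refl] by blast
  let ?w = "\<lambda>\<xi> r. ennreal (exp (r * f \<xi>) * (exp r - 1) powr (- (\<alpha> + 1)))"
  {
    case (cong h g)
    then show ?case by simp
  next
    case (set A)
    have space_levy: "space (lamperti_levy \<alpha> f \<sigma>) = - {0}"
      using sets_eq_imp_space_eq[OF sets_lamperti_levy[of \<alpha> f \<sigma>]] by (simp add: space_restrict_space)
    have A: "A - {0} \<in> sets (restrict_space borel (- {0}))"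
      using set by (auto simp: sets_restrict_space_iff)
    have "(\<integral>\<^sup>+x. indicator A x \<partial>lamperti_levy \<alpha> f \<sigma>) = (\<integral>\<^sup>+x. indicator (A - {0}) x \<partial>lamperti_levy \<alpha> f \<sigma>)"
      by (rule nn_integral_cong) (auto simp: space_levy indicator_def)
    also have "\<dots> = emeasure (lamperti_levy \<alpha> f \<sigma>) (A - {0})"
      using A by (intro nn_integral_indicator) simp
    also have "\<dots> = (\<integral>\<^sup>+\<xi>. (\<integral>\<^sup>+r\<in>{0<..}. indicator (A - {0}) (r *\<^sub>R \<xi>) * ?w \<xi> r \<partial>lborel) \<partial>\<sigma>)"
      by (rule emeasure_lamperti_levy[OF params A])
    also have "\<dots> = (\<integral>\<^sup>+\<xi>. (\<integral>\<^sup>+r\<in>{0<..}. indicator A (r *\<^sub>R \<xi>) * ?w \<xi> r \<partial>lborel) \<partial>\<sigma>)"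
    proof (intro nn_integral_cong)
      fix \<xi> :: "real^'n" and r :: real assume "\<xi> \<in> space \<sigma>"
      then have "\<xi> \<noteq> 0" using lamperti_parameters_measurable(3)[OF params] by auto
      then show "indicator (A - {0}) (r *\<^sub>R \<xi>) * ?w \<xi> r * indicator {0<..} r
          = indicator A (r *\<^sub>R \<xi>) * ?w \<xi> r * indicator {0<..} r"
        by (auto simp: indicator_def)
    qed
    finally show ?case .
  next
    case (mult u c)
    note [measurable] = mult(2)
    have "(\<integral>\<^sup>+x. c * u x \<partial>lamperti_levy \<alpha> f \<sigma>) = c * (\<integral>\<^sup>+x. u x \<partial>lamperti_levy \<alpha> f \<sigma>)"
      by (rule nn_integral_cmult[OF levy_meas[OF mult(2)]])
    then show ?case
      by (simp add: mult nn_integral_cmult mult.assoc)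
  next
    case (add u v)
    note [measurable] = add.hyps(1) add.hyps(3)
    have "(\<integral>\<^sup>+x. v x + u x \<partial>lamperti_levy \<alpha> f \<sigma>)
        = (\<integral>\<^sup>+x. v x \<partial>lamperti_levy \<alpha> f \<sigma>) + (\<integral>\<^sup>+x. u x \<partial>lamperti_levy \<alpha> f \<sigma>)"
      by (rule nn_integral_add[OF levy_meas[OF add.hyps(3)] levy_meas[OF add.hyps(1)]])
    then show ?case
      by (simp add: add nn_integral_add distrib_right)
  next
    case (seq U)
    note [measurable] = seq(1)
    have "(\<integral>\<^sup>+x. (SUP i. U i) x \<partial>lamperti_levy \<alpha> f \<sigma>) = (SUP i. \<integral>\<^sup>+x. U i x \<partial>lamperti_levy \<alpha> f \<sigma>)"
      unfolding SUP_apply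
      by (rule nn_integral_monotone_convergence_SUP[OF seq.hyps(3) levy_meas[OF seq.hyps(1)]])
    also have "\<dots> = (SUP i. \<integral>\<^sup>+\<xi>. (\<integral>\<^sup>+r\<in>{0<..}. U i (r *\<^sub>R \<xi>) * ?w \<xi> r \<partial>lborel) \<partial>\<sigma>)"
      by (simp add: seq)
    also have "\<dots> = (\<integral>\<^sup>+\<xi>. (SUP i. \<integral>\<^sup>+r\<in>{0<..}. U i (r *\<^sub>R \<xi>) * ?w \<xi> r \<partial>lborel) \<partial>\<sigma>)"
      using seq(3) by (intro nn_integral_monotone_convergence_SUP[symmetric])
        (auto simp: incseq_def le_fun_def intro!: nn_integral_mono mult_right_mono)
    also have "\<dots> = (\<integral>\<^sup>+\<xi>. (\<integral>\<^sup>+r\<in>{0<..}. (SUP i. U i (r *\<^sub>R \<xi>)) * ?w \<xi> r \<partial>lborel) \<partial>\<sigma>)"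
      unfolding SUP_mult_right_ennreal using seq(3)
      by (intro nn_integral_cong nn_integral_monotone_convergence_SUP[symmetric])
        (auto simp: incseq_def le_fun_def intro!: mult_right_mono)
    finally show ?case unfolding SUP_apply .
  }
qed

lemma nn_integral_exp_decay_finite:
  assumes "0 < \<delta>"
  shows "(\<integral>\<^sup>+r\<in>{1..}. ennreal (exp (- (\<delta> * r))) \<partial>lborel) < \<infinity>"
proof -
  have "((\<lambda>r::real. - exp (- (\<delta> * r)) / \<delta>) \<longlongrightarrow> 0) at_top"
    using assms by real_asymp
  then have "(\<integral>\<^sup>+r. ennreal (exp (- (\<delta> * r))) * indicator {1..} r \<partial>lborel)
      = ennreal (0 - (- exp (- (\<delta> * 1)) / \<delta>))"
    using assms by (intro nn_integral_FTC_atLeast) (auto intro!: derivative_eq_intros)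
  then show ?thesis by simp
qed

text \<open>Small jumps are handled by the integrability condition on a Levy measure.  For \<open>r > 1\<close> the
estimate \<open>e\<^sup>r - 1 \<ge> (1 - e\<^sup>-\<^sup>1) e\<^sup>r\<close> bounds the radial integrand by a multiple of \<open>exp (- \<delta> r)\<close>.\<close>

lemma lamperti_levy_cosh_finite:
  fixes \<sigma> :: "(real^'n) measure"
  assumes params: "lamperti_parameters \<alpha> f \<sigma>" and levy: "levy_measure (lamperti_levy \<alpha> f \<sigma>)"
    and \<theta>: "0 < \<theta>" "\<theta> < \<alpha> + 1 - (SUP \<xi>\<in>sphere 0 1. f \<xi>)"
  shows "(\<integral>\<^sup>+x. ennreal (cosh (\<theta> * norm x) - 1) \<partial>lamperti_levy \<alpha> f \<sigma>) < \<infinity>"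
proof -
  let ?\<nu> = "lamperti_levy \<alpha> f \<sigma>"
  let ?\<gamma> = "SUP \<xi>\<in>sphere 0 1. f \<xi>"
  let ?K = "(1 - exp (- 1)) powr (- (\<alpha> + 1)) :: real"
  define \<delta> where "\<delta> = \<alpha> + 1 - ?\<gamma> - \<theta>"
  have \<delta>: "0 < \<delta>" using \<theta> by (simp add: \<delta>_def)
  have \<alpha>: "0 < \<alpha>" and bdd: "bdd_above (f ` sphere 0 1)" and fin_\<sigma>: "finite_measure \<sigma>"
    using params by (auto simp: lamperti_parameters_def)
  interpret \<sigma>: finite_measure \<sigma> by fact
  have id [measurable]: "(\<lambda>x. x) \<in> ?\<nu> \<rightarrow>\<^sub>M borel"
    by (simp add: measurable_restrict_space1 cong: measurable_cong_sets)
  have tail: "(\<integral>\<^sup>+x. ennreal (exp (\<theta> * norm x) * indicator {1<..} (norm x)) \<partial>?\<nu>) < \<infinity>"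
  proof -
    have "(\<integral>\<^sup>+x. ennreal (exp (\<theta> * norm x) * indicator {1<..} (norm x)) \<partial>?\<nu>)
        = (\<integral>\<^sup>+\<xi>. (\<integral>\<^sup>+r\<in>{0<..}. ennreal (exp (\<theta> * norm (r *\<^sub>R \<xi>)) * indicator {1<..} (norm (r *\<^sub>R \<xi>)))
            * ennreal (exp (r * f \<xi>) * (exp r - 1) powr (- (\<alpha> + 1))) \<partial>lborel) \<partial>\<sigma>)"
      by (rule nn_integral_lamperti_levy[OF params]) measurable
    also have "\<dots> \<le> (\<integral>\<^sup>+\<xi>. (\<integral>\<^sup>+r\<in>{1..}. ennreal ?K * ennreal (exp (- (\<delta> * r))) \<partial>lborel) \<partial>\<sigma>)"
    proof (intro nn_integral_mono)
      fix \<xi> :: "real^'n" and r :: real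
      assume "\<xi> \<in> space \<sigma>"
      then have \<xi>: "norm \<xi> = 1" using lamperti_parameters_measurable(3)[OF params] by simp
      have "exp (\<theta> * r) * (exp (r * f \<xi>) * (exp r - 1) powr (- (\<alpha> + 1))) \<le> ?K * exp (- (\<delta> * r))"
        if r: "1 < r"
      proof -
        have "f \<xi> \<le> ?\<gamma>" using bdd \<xi> by (intro cSUP_upper) auto
        then have f_le: "exp (r * f \<xi>) \<le> exp (r * ?\<gamma>)" using r by simp
        have "exp r * (1 - exp (- 1)) \<le> exp r - 1"
          using r by (simp add: right_diff_distrib flip: exp_add)
        then have "(exp r - 1) powr (- (\<alpha> + 1)) \<le> (exp r * (1 - exp (- 1))) powr (- (\<alpha> + 1))"
          using \<alpha> by (intro powr_mono2') auto
        also have "\<dots> = exp (- (r * (\<alpha> + 1))) * ?K"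
          by (simp add: powr_mult exp_powr_real) (simp add: algebra_simps)
        finally have w_le: "(exp r - 1) powr (- (\<alpha> + 1)) \<le> exp (- (r * (\<alpha> + 1))) * ?K" .
        have "exp (\<theta> * r) * (exp (r * f \<xi>) * (exp r - 1) powr (- (\<alpha> + 1)))
            \<le> exp (\<theta> * r) * (exp (r * ?\<gamma>) * (exp (- (r * (\<alpha> + 1))) * ?K))"
          by (intro mult_left_mono mult_mono f_le w_le) auto
        also have "\<dots> = ?K * exp (\<theta> * r + r * ?\<gamma> - r * (\<alpha> + 1))"
          by (simp add: exp_diff exp_add exp_minus field_simps)
        also have "\<theta> * r + r * ?\<gamma> - r * (\<alpha> + 1) = - (\<delta> * r)"
          by (simp add: \<delta>_def algebra_simps)
        finally show ?thesis .
      qed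
      then show "ennreal (exp (\<theta> * norm (r *\<^sub>R \<xi>)) * indicator {1<..} (norm (r *\<^sub>R \<xi>)))
          * ennreal (exp (r * f \<xi>) * (exp r - 1) powr (- (\<alpha> + 1))) * indicator {0<..} r
          \<le> ennreal ?K * ennreal (exp (- (\<delta> * r))) * indicator {1..} r"
        using \<xi> by (auto simp: indicator_def ennreal_leI simp flip: ennreal_mult)
    qed
    also have "\<dots> = ennreal ?K * (\<integral>\<^sup>+r\<in>{1..}. ennreal (exp (- (\<delta> * r))) \<partial>lborel) * emeasure \<sigma> (space \<sigma>)"
      by (simp add: nn_integral_cmult mult.assoc)
    also have "\<dots> < \<infinity>"
      using nn_integral_exp_decay_finite[OF \<delta>]
      by (simp add: ennreal_mult_less_top \<sigma>.emeasure_eq_measure)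
    finally show ?thesis .
  qed
  have "(\<integral>\<^sup>+x. ennreal (cosh (\<theta> * norm x) - 1) \<partial>?\<nu>)
      \<le> (\<integral>\<^sup>+x. ennreal (cosh \<theta>) * ennreal (min 1 ((norm x)\<^sup>2))
           + ennreal (exp (\<theta> * norm x) * indicator {1<..} (norm x)) \<partial>?\<nu>)"
  proof (rule nn_integral_mono)
    fix x :: "real^'n"
    have "cosh (\<theta> * norm x) - 1 \<le> cosh \<theta> * min 1 ((norm x)\<^sup>2) + exp (\<theta> * norm x) * indicator {1<..} (norm x)"
      using \<theta> by (intro cosh_minus_one_le) auto
    then have le: "ennreal (cosh (\<theta> * norm x) - 1)
        \<le> ennreal (cosh \<theta> * min 1 ((norm x)\<^sup>2) + exp (\<theta> * norm x) * indicator {1<..} (norm x))"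
      by (rule ennreal_leI)
    show "ennreal (cosh (\<theta> * norm x) - 1) \<le> ennreal (cosh \<theta>) * ennreal (min 1 ((norm x)\<^sup>2))
        + ennreal (exp (\<theta> * norm x) * indicator {1<..} (norm x))"
    proof -
      have "ennreal (cosh \<theta> * min 1 ((norm x)\<^sup>2) + exp (\<theta> * norm x) * indicator {1<..} (norm x))
          = ennreal (cosh \<theta> * min 1 ((norm x)\<^sup>2)) + ennreal (exp (\<theta> * norm x) * indicator {1<..} (norm x))"
        by (rule ennreal_plus) (auto simp: cosh_real_nonneg)
      moreover have "ennreal (cosh \<theta> * min 1 ((norm x)\<^sup>2)) = ennreal (cosh \<theta>) * ennreal (min 1 ((norm x)\<^sup>2))"
        by (rule ennreal_mult) (auto simp: cosh_real_nonneg)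
      ultimately show ?thesis
        using le by (simp only:)
    qed
  qed
  also have "\<dots> = ennreal (cosh \<theta>) * (\<integral>\<^sup>+x. ennreal (min 1 ((norm x)\<^sup>2)) \<partial>?\<nu>)
      + (\<integral>\<^sup>+x. ennreal (exp (\<theta> * norm x) * indicator {1<..} (norm x)) \<partial>?\<nu>)"
    by (simp add: nn_integral_add nn_integral_cmult)
  also have "\<dots> < \<infinity>"
    using tail levy by (simp add: levy_measure_def ennreal_mult_less_top)
  finally show ?thesis .
qed

text \<open>At the critical exponent the growth of \<open>cosh (c r)\<close> cancels the decay \<open>exp (- c r)\<close> of the radial
density, so that the radial integrand exceeds a positive constant on \<open>r > 1\<close>.\<close>

lemma lamperti_levy_cosh_infinite:
  fixes \<sigma> :: "(real^'n) measure"
  assumes params: "lamperti_parameters \<alpha> f \<sigma>"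
    and f: "\<And>\<xi>. \<xi> \<in> sphere 0 1 \<Longrightarrow> f \<xi> = \<kappa>" and \<kappa>: "\<kappa> < \<alpha> + 1"
  shows "(\<integral>\<^sup>+x. ennreal (cosh ((\<alpha> + 1 - \<kappa>) * norm x) - 1) \<partial>lamperti_levy \<alpha> f \<sigma>) = \<infinity>"
proof -
  define c where "c = \<alpha> + 1 - \<kappa>"
  define d where "d = (1 - exp (- c))\<^sup>2 / 2"
  have c: "0 < c" using \<kappa> by (simp add: c_def)
  then have d: "0 < d" by (simp add: d_def)
  have \<alpha>: "0 < \<alpha>" and \<sigma>: "emeasure \<sigma> (space \<sigma>) \<noteq> 0"
    using params by (auto simp: lamperti_parameters_def)
  have "(\<infinity>::ennreal) = (\<integral>\<^sup>+\<xi>. (\<integral>\<^sup>+r\<in>{1::real<..}. ennreal d \<partial>lborel) \<partial>\<sigma>)"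
  proof -
    have "emeasure lborel {1::real<..} = \<infinity>"
    proof (rule ccontr)
      assume "emeasure lborel {1::real<..} \<noteq> \<infinity>"
      then obtain m where m: "0 \<le> m" "emeasure lborel {1::real<..} = ennreal m"
        by (cases "emeasure lborel {1::real<..}") auto
      have "ennreal (m + 1) = emeasure lborel {1<..2 + m}"
        using m by simp
      also have "\<dots> \<le> emeasure lborel {1::real<..}"
        by (intro emeasure_mono) auto
      finally show False using m by simp
    qed
    moreover have "(\<integral>\<^sup>+r\<in>{1::real<..}. ennreal d \<partial>lborel) = ennreal d * emeasure lborel {1::real<..}"
      by (rule nn_integral_cmult_indicator) simp
    ultimately show ?thesis
      using d \<sigma> by (simp add: ennreal_mult_top ennreal_top_mult)
  qed
  also have "\<dots> \<le> (\<integral>\<^sup>+\<xi>. (\<integral>\<^sup>+r\<in>{0<..}. ennreal (cosh (c * norm (r *\<^sub>R \<xi>)) - 1)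
      * ennreal (exp (r * f \<xi>) * (exp r - 1) powr (- (\<alpha> + 1))) \<partial>lborel) \<partial>\<sigma>)"
  proof (intro nn_integral_mono)
    fix \<xi> :: "real^'n" and r :: real
    assume "\<xi> \<in> space \<sigma>"
    then have \<xi>: "norm \<xi> = 1" using lamperti_parameters_measurable(3)[OF params] by simp
    have "d \<le> (cosh (c * r) - 1) * (exp (r * f \<xi>) * (exp r - 1) powr (- (\<alpha> + 1)))" if r: "1 < r"
    proof -
      have "d * exp (c * r) \<le> cosh (c * r) - 1"
        unfolding d_def using c r by (intro cosh_minus_one_ge) auto
      moreover have "exp (- (r * (\<alpha> + 1))) \<le> (exp r - 1) powr (- (\<alpha> + 1))"
      proof -
        have "exp r powr (- (\<alpha> + 1)) \<le> (exp r - 1) powr (- (\<alpha> + 1))"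
          using r \<alpha> by (intro powr_mono2') auto
        then show ?thesis by (simp add: exp_powr_real algebra_simps)
      qed
      ultimately have "(d * exp (c * r)) * (exp (r * f \<xi>) * exp (- (r * (\<alpha> + 1))))
          \<le> (cosh (c * r) - 1) * (exp (r * f \<xi>) * (exp r - 1) powr (- (\<alpha> + 1)))"
        using d by (intro mult_mono mult_left_mono) (auto simp: cosh_real_ge_1)
      moreover have "(d * exp (c * r)) * (exp (r * f \<xi>) * exp (- (r * (\<alpha> + 1))))
          = d * exp (c * r + r * f \<xi> - r * (\<alpha> + 1))"
        by (simp add: exp_diff exp_add exp_minus field_simps)
      moreover have "c * r + r * f \<xi> - r * (\<alpha> + 1) = 0"
        using f[of \<xi>] \<xi> by (simp add: c_def algebra_simps)
      ultimately show ?thesis by simp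
    qed
    then show "ennreal d * indicator {1<..} r
        \<le> ennreal (cosh (c * norm (r *\<^sub>R \<xi>)) - 1)
          * ennreal (exp (r * f \<xi>) * (exp r - 1) powr (- (\<alpha> + 1))) * indicator {0<..} r"
      using \<xi> by (auto simp: indicator_def ennreal_leI cosh_real_ge_1 simp flip: ennreal_mult)
  qed
  also have "\<dots> = (\<integral>\<^sup>+x. ennreal (cosh (c * norm x) - 1) \<partial>lamperti_levy \<alpha> f \<sigma>)"
    by (rule nn_integral_lamperti_levy[OF params, symmetric]) measurable
  finally show ?thesis
    by (simp add: c_def top_unique)
qed

section \<open>Moments of Lamperti stable laws\<close>

text \<open>This is \<open>u \<le> e\<^sup>u\<close> at \<open>u = \<theta> y / p\<close>, raised to the power \<open>p\<close>.\<close>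

lemma powr_le_exp:
  fixes y p \<theta> :: real
  assumes "0 \<le> y" "0 < p" "0 < \<theta>"
  shows "y powr p \<le> (p / \<theta>) powr p * exp (\<theta> * y)"
proof -
  have "\<theta> * y / p \<le> exp (\<theta> * y / p)"
    using exp_ge_add_one_self[of "\<theta> * y / p"] by linarith
  then have "(\<theta> * y / p) powr p \<le> exp (\<theta> * y / p) powr p"
    using assms by (intro powr_mono2) auto
  then have "(p / \<theta>) powr p * (\<theta> * y / p) powr p \<le> (p / \<theta>) powr p * exp (\<theta> * y)"
    using assms by (intro mult_left_mono) (simp_all add: exp_powr_real)
  moreover have "(p / \<theta>) powr p * (\<theta> * y / p) powr p = y powr p"
    using assms by (simp flip: powr_mult)
  ultimately show ?thesis by simp
qed

theorem proposition1:
  fixes \<alpha> :: real and f :: "real^'n \<Rightarrow> real" and \<sigma> \<mu> :: "(real^'n) measure"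
  assumes "lamperti_stable \<alpha> f \<sigma> \<mu>"
  shows "(\<forall>p>0. (\<integral>\<^sup>+x. ennreal (norm x powr p) \<partial>\<mu>) < \<infinity>) \<and>
    (\<forall>\<zeta>. \<zeta> < \<alpha> + 1 - (SUP \<xi>\<in>sphere 0 1. f \<xi>) \<longrightarrow>
       (\<integral>\<^sup>+x. ennreal (exp (\<zeta> * norm x)) \<partial>\<mu>) < \<infinity>) \<and>
    (\<forall>\<kappa>. \<kappa> < \<alpha> + 1 \<and> (\<forall>\<xi>\<in>sphere 0 1. f \<xi> = \<kappa>) \<longrightarrow>
       (\<forall>\<zeta>. (\<integral>\<^sup>+x. ennreal (exp (\<zeta> * norm x)) \<partial>\<mu>) < \<infinity> \<longleftrightarrow> \<zeta> < \<alpha> + 1 - \<kappa>))"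
proof -
  define R where "R = \<alpha> + 1 - (SUP \<xi>\<in>sphere 0 1. f \<xi>)"
  have params: "lamperti_parameters \<alpha> f \<sigma>" and id: "infinitely_divisible \<mu>"
    using assms by (auto simp: lamperti_stable_def)
  obtain b where triplet: "has_generating_triplet \<mu> 0 (lamperti_levy \<alpha> f \<sigma>) b"
    using assms by (auto simp: lamperti_stable_def)
  have R: "0 < R" using params by (simp add: R_def lamperti_parameters_def)
  have sets_\<mu> [measurable_cong]: "sets \<mu> = sets borel"
    using id by (simp add: infinitely_divisible_def)
  interpret infinitely_divisible_exp_jumps \<mu> "lamperti_levy \<alpha> f \<sigma>" b R
  proof (rule infinitely_divisible_exp_jumps.intro)
    show "prob_space \<mu>" using id by (simp add: infinitely_divisible_def)
    have "levy_measure (lamperti_levy \<alpha> f \<sigma>)"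
      using triplet by (simp add: has_generating_triplet_def)
    then show "(\<integral>\<^sup>+x. ennreal (cosh (\<theta> * norm x) - 1) \<partial>lamperti_levy \<alpha> f \<sigma>) < \<infinity>"
      if "0 < \<theta>" "\<theta> < R" for \<theta>
      using that unfolding R_def by (intro lamperti_levy_cosh_finite[OF params])
  qed (fact sets_\<mu> triplet R)+
  have moments: "(\<integral>\<^sup>+x. ennreal (norm x powr p) \<partial>\<mu>) < \<infinity>" if p: "0 < p" for p
  proof -
    have "(\<integral>\<^sup>+x. ennreal (norm x powr p) \<partial>\<mu>)
        \<le> (\<integral>\<^sup>+x. ennreal ((p / (R / 2)) powr p) * ennreal (exp (R / 2 * norm x)) \<partial>\<mu>)"
      using powr_le_exp[of _ p "R / 2"] p R
      by (intro nn_integral_mono) (simp add: ennreal_leI flip: ennreal_mult)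
    also have "\<dots> = ennreal ((p / (R / 2)) powr p) * (\<integral>\<^sup>+x. ennreal (exp (R / 2 * norm x)) \<partial>\<mu>)"
      by (rule nn_integral_cmult) measurable
    also have "\<dots> < \<infinity>"
      using exp_norm_finite[of "R / 2"] R by (simp add: ennreal_mult_less_top)
    finally show ?thesis .
  qed
  have sharp: "(\<integral>\<^sup>+x. ennreal (exp (\<zeta> * norm x)) \<partial>\<mu>) < \<infinity> \<longleftrightarrow> \<zeta> < \<alpha> + 1 - \<kappa>"
    if \<kappa>: "\<kappa> < \<alpha> + 1" and f: "\<forall>\<xi>\<in>sphere 0 1. f \<xi> = \<kappa>" for \<kappa> \<zeta>
  proof
    have nonempty: "axis undefined 1 \<in> sphere (0 :: real^'n) 1" by (simp add: norm_axis_1)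
    have "f ` sphere 0 1 = (\<lambda>_ :: real^'n. \<kappa>) ` sphere 0 1"
      using f by (intro image_cong) auto
    also have "\<dots> = {\<kappa>}"
      using nonempty by (rule image_constant)
    finally have R_eq: "R = \<alpha> + 1 - \<kappa>" by (simp add: R_def)
    then show "(\<integral>\<^sup>+x. ennreal (exp (\<zeta> * norm x)) \<partial>\<mu>) < \<infinity>" if "\<zeta> < \<alpha> + 1 - \<kappa>"
      using that by (intro exp_norm_finite) simp
    \<comment> \<open>Finiteness at or beyond the critical exponent would make the critical integral over \<open>\<nu>\<close> finite.\<close>
    assume fin: "(\<integral>\<^sup>+x. ennreal (exp (\<zeta> * norm x)) \<partial>\<mu>) < \<infinity>"
    show "\<zeta> < \<alpha> + 1 - \<kappa>"
    proof (rule ccontr)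
      assume "\<not> \<zeta> < \<alpha> + 1 - \<kappa>"
      then have "(\<integral>\<^sup>+x. ennreal (exp ((\<alpha> + 1 - \<kappa>) * norm x)) \<partial>\<mu>) < \<infinity>"
        by (intro order_le_less_trans[OF _ fin] nn_integral_mono ennreal_leI) (simp add: mult_right_mono)
      then have "2 * (\<integral>\<^sup>+x. ennreal (cosh ((\<alpha> + 1 - \<kappa>) * norm x) - 1) \<partial>lamperti_levy \<alpha> f \<sigma>) < \<infinity>"
        using \<kappa> by (intro order_le_less_trans[OF cosh_levy_integral_le]) (simp_all add: power2_eq_square ennreal_mult_less_top)
      then show False
        using lamperti_levy_cosh_infinite[OF params _ \<kappa>] f by (simp add: ennreal_mult_top)
    qed
  qed
  show ?thesis
    using moments exp_norm_finite[unfolded R_def] sharp by (intro conjI allI impI) simp_all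
qed

end
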